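(* Let $G$ be a group and let $1\le m\le n$ be integers. Let $\{T_i\trianglelefteq G^i \mid m+1\le i\le n\}$ be a closed set of (permutation) invariant normal subgroups, and let $L\trianglelefteq G\wr\mathcal{S}_m$ be such that $\{(t;1)\mid t\in T_{m+1}\pi_{m+1}\}\subseteq L$ (a condition that is vacuous if $m=n$). Then $$\rho(m,\{T_i\},L)=I_{m-1}^\star\cup\overline{\sigma_L}\cup\chi(G,G^2,\dots,G^{m-1},T_{m+1}\pi_{m+1},T_{m+1},\dots,T_n)$$ is a congruence on $G\wr\mathcal{I}_n$. Moreover, all congruences on $G\wr\mathcal{I}_n$ are of this form.
   Context: Maps are written on the right and composed left to right; $[n]=\{1,\dots,n\}$. $\mathcal{I}_n$ is the symmetric inverse monoid of all partial bijections of $[n]$, $\mathrm{rk}(a)=|\mathrm{Im}(a)|$. Put $G^0=G\cup\{0\}$ with $0g=g0=0$. For $h\in (G^0)^n$ and $a\in\mathcal{I}_n$ write $h_a=(h_{1a},\dots,h_{na})$, with $h_{ia}=0$ if $ia$ is undefined. The monoid $G\wr\mathcal{I}_n$ is $$G\wr\mathcal{I}_n=\{(g;a)\in (G^0)^n\times\mathcal{I}_n\mid g_i\neq0\iff i\in\mathrm{Dom}(a)\},\qquad (g;a)(h;b)=(gh_a;ab)$$ (products in $(G^0)^n$ componentwise). It is an inverse monoid (isomorphic to the partial automorphism monoid of the free $G$-act of rank $n$). For a tuple $g\in(G^0)^n$ with exactly $r$ non-zero entries, $g\Omega\in G^r$ denotes the tuple obtained by deleting the zero entries; $g^{-1}$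 is the entrywise inverse with $0^{-1}=0$. A subgroup $K\le G^i$ is (permutation) invariant if for all $\sigma\in\mathcal{S}_i$, $(g_1,\dots,g_i)\in K\iff(g_{1\sigma},\dots,g_{i\sigma})\in K$. $\pi_i$ denotes the projection $G^i\to G^{i-1}$ onto the first $i-1$ coordinates. The set $\{T_i\mid m+1\le i\le n\}$ is closed if $T_i\pi_i\subseteq T_{i-1}$ for all $m+2\le i\le n$. $G\wr\mathcal{S}_m$ is the wreath product, i.e. the set $G^m\times\mathcal{S}_m$ with $(g;\sigma)(h;\tau)=(gh_\sigma;\sigma\tau)$, $h_\sigma=(h_{1\sigma},\dots,h_{m\sigma})$. For an idempotent $e\in\mathcal{I}_n$ of rank $m$ let $H_e=\{(g;a)\in G\wr\mathcal{I}_n\mid \mathrm{Dom}(a)=\mathrm{Im}(a)=\mathrm{Dom}(e)\}$ and let $\Psi_e\colon H_e\to G\wr\mathcal{S}_m$ be the isomorphism $(g;a)\mapsto(g\Omega;a\gamma)$, where $a\gamma\in\mathcal{S}_m$ is obtained from $a$ by identifying $\mathrm{Dom}(e)$ with $[m]$ via the order-preserving bijection. Put $L_e=\{(g;a)\in H_e\mid (g;a)\Psi_e\in L\}$. The constituents of $\rho(m,\{T_i\},L)$ are as follows. $I_{m-1}^\star$ is the Rees congruence: the identity relation together with all pairs $((g;a),(h;b))$ with $\mathrm{rk}(a)\le m-1$ and $\mathrm{rk}(b)\le m-1$. $\overline{\sigma_L}$ is the set of pairs $((g;a),(h;b))$ with $\mathrm{rk}(a)=m=\mathrm{rk}(b)$,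 with $a,b$ being $\mathcal{H}$-related in $\mathcal{I}_n$ (same domain and same image), and with $(g;a)^{-1}(h;b)=((g^{-1}h)_{a^{-1}};a^{-1}b)\in L_{a^{-1}a}$. For a sequence of invariant normal subgroups $U_i\trianglelefteq G^i$ ($1\le i\le n$), $\chi(U_1,\dots,U_n)=\{((g;a),(h;a))\mid a\in\mathcal{I}_n,\ \mathrm{rk}(a)=i,\ (h^{-1}g)\Omega\in U_i\}$ (for $\mathrm{rk}(a)=0$ there is only one element, related to itself); if $m=n$ the term $T_{m+1}\pi_{m+1}$ in position $m$ is read as the trivial group. Explicitly, with $\rho=\rho(m,\{T_i\},L)$: $(g;a)\,\rho\,(h;b)$ if and only if one of the following holds: (1) $\mathrm{rk}(a)<m$ and $\mathrm{rk}(b)<m$; (2) $\mathrm{rk}(a)>m$, $a=b$ and $(g^{-1}h)\Omega\in T_{\mathrm{rk}(a)}$; (3) $\mathrm{rk}(a)=m=\mathrm{rk}(b)$, $a\,\mathcal{H}\,b$ in $\mathcal{I}_n$, and $((g^{-1}h)_{a^{-1}};a^{-1}b)\in L_{a^{-1}a}$.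
   Formalization: The claim that all congruences are of this form is proved for every congruence except the universal one, which is never of the form ρ(m,{T_i},L) with 1≤m≤n, since such a relation never relates the identity (rank n) to the zero element (rank 0). *)

theory Defs
  imports "HOL-Algebra.Product_Groups" "HOL-Algebra.Coset" "HOL-Combinatorics.Permutations"
begin

section \<open>Powers of a group and the wreath product with a symmetric group\<close>

text \<open>Tuples in \<open>G^i\<close> are extensional functions on \<open>{1..i}\<close>.\<close>

definition power_group :: "('g, 'c) monoid_scheme \<Rightarrow> nat \<Rightarrow> (nat \<Rightarrow> 'g) monoid"
  where "power_group G i = product_group {1..i} (\<lambda>_. G)"

definition perm_invariant :: "('g, 'c) monoid_scheme \<Rightarrow> nat \<Rightarrow> (nat \<Rightarrow> 'g) set \<Rightarrow> bool"
  where "perm_invariant G i K \<longleftrightarrow>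
    (\<forall>\<sigma>. \<sigma> permutes {1..i} \<longrightarrow>
      (\<forall>g \<in> carrier (power_group G i). g \<in> K \<longleftrightarrow> (\<lambda>j\<in>{1..i}. g (\<sigma> j)) \<in> K))"

text \<open>The projection \<open>\<pi>\<^sub>i : G^i \<rightarrow> G^(i-1)\<close> onto the first \<open>i - 1\<close> coordinates.\<close>

definition proj :: "nat \<Rightarrow> (nat \<Rightarrow> 'g) \<Rightarrow> nat \<Rightarrow> 'g"
  where "proj i g = restrict g {1..i - 1}"

definition closed_family :: "nat \<Rightarrow> nat \<Rightarrow> (nat \<Rightarrow> (nat \<Rightarrow> 'g) set) \<Rightarrow> bool"
  where "closed_family m n T \<longleftrightarrow> (\<forall>i \<in> {m + 2..n}. proj i ` T i \<subseteq> T (i - 1))"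

text \<open>Maps act on the right and are composed left to right, so the product written
  \<open>\<sigma>\<tau>\<close> is \<open>\<tau> \<circ> \<sigma>\<close>.\<close>

definition wreath_sym :: "('g, 'c) monoid_scheme \<Rightarrow> nat \<Rightarrow> ((nat \<Rightarrow> 'g) \<times> (nat \<Rightarrow> nat)) monoid"
  where "wreath_sym G m =
    \<lparr>carrier = carrier (power_group G m) \<times> {\<sigma>. \<sigma> permutes {1..m}},
     monoid.mult = (\<lambda>(g, \<sigma>) (h, \<tau>). (g \<otimes>\<^bsub>power_group G m\<^esub> (\<lambda>i\<in>{1..m}. h (\<sigma> i)), \<tau> \<circ> \<sigma>)),
     one = (\<one>\<^bsub>power_group G m\<^esub>, id)\<rparr>"

section \<open>The symmetric inverse monoid\<close>

text \<open>A partial bijection of \<open>{1..n}\<close> is a map with \<open>a i = None\<close> where \<open>i a\<close> is undefined.\<close>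

definition sym_inv :: "nat \<Rightarrow> (nat \<rightharpoonup> nat) set"
  where "sym_inv n = {a. dom a \<subseteq> {1..n} \<and> ran a \<subseteq> {1..n} \<and> inj_on a (dom a)}"

definition pmult :: "(nat \<rightharpoonup> nat) \<Rightarrow> (nat \<rightharpoonup> nat) \<Rightarrow> (nat \<rightharpoonup> nat)"
  where "pmult a b = b \<circ>\<^sub>m a"

definition pinv :: "(nat \<rightharpoonup> nat) \<Rightarrow> (nat \<rightharpoonup> nat)"
  where "pinv a = (\<lambda>j. if j \<in> ran a then Some (THE i. a i = Some j) else None)"

definition rk :: "(nat \<rightharpoonup> nat) \<Rightarrow> nat"
  where "rk a = card (ran a)"

definition H_related :: "(nat \<rightharpoonup> nat) \<Rightarrow> (nat \<rightharpoonup> nat) \<Rightarrow> bool"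
  where "H_related a b \<longleftrightarrow> dom a = dom b \<and> ran a = ran b"

section \<open>The monoid of partial automorphisms\<close>

text \<open>\<open>G\<^sup>0\<close> is rendered as the option type over \<open>G\<close>, with \<open>None\<close> in the role of \<open>0\<close>.
  A tuple in \<open>(G\<^sup>0)^n\<close> is a function that is \<open>None\<close> outside \<open>{1..n}\<close>; thus \<open>dom g\<close> is the
  set of indices of its non-zero entries.\<close>

definition tuples0 :: "('g, 'c) monoid_scheme \<Rightarrow> nat \<Rightarrow> (nat \<Rightarrow> 'g option) set"
  where "tuples0 G n = {g. dom g \<subseteq> {1..n} \<and> ran g \<subseteq> carrier G}"

fun mult0 :: "('g, 'c) monoid_scheme \<Rightarrow> 'g option \<Rightarrow> 'g option \<Rightarrow> 'g option"
  where
    "mult0 G (Some x) (Some y) = Some (x \<otimes>\<^bsub>G\<^esub> y)"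
  | "mult0 G None _ = None"
  | "mult0 G _ None = None"

definition tmult :: "('g, 'c) monoid_scheme \<Rightarrow> (nat \<Rightarrow> 'g option) \<Rightarrow> (nat \<Rightarrow> 'g option) \<Rightarrow> nat \<Rightarrow> 'g option"
  where "tmult G g h = (\<lambda>i. mult0 G (g i) (h i))"

definition tinv :: "('g, 'c) monoid_scheme \<Rightarrow> (nat \<Rightarrow> 'g option) \<Rightarrow> nat \<Rightarrow> 'g option"
  where "tinv G g = (\<lambda>i. map_option (\<lambda>x. inv\<^bsub>G\<^esub> x) (g i))"

text \<open>The tuple \<open>h\<^sub>a\<close> with entries \<open>h\<^bsub>ia\<^esub>\<close>, and \<open>0\<close> where \<open>ia\<close> is undefined.\<close>

definition reindex :: "(nat \<Rightarrow> 'g option) \<Rightarrow> (nat \<rightharpoonup> nat) \<Rightarrow> nat \<Rightarrow> 'g option"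
  where "reindex h a = h \<circ>\<^sub>m a"

type_synonym 'g pelem = "(nat \<Rightarrow> 'g option) \<times> (nat \<rightharpoonup> nat)"

definition wreath_inv :: "('g, 'c) monoid_scheme \<Rightarrow> nat \<Rightarrow> 'g pelem monoid"
  where "wreath_inv G n =
    \<lparr>carrier = {(g, a). g \<in> tuples0 G n \<and> a \<in> sym_inv n \<and> (\<forall>i\<in>{1..n}. g i \<noteq> None \<longleftrightarrow> i \<in> dom a)},
     monoid.mult = (\<lambda>(g, a) (h, b). (tmult G g (reindex h a), pmult a b)),
     one = (\<lambda>i. if i \<in> {1..n} then Some \<one>\<^bsub>G\<^esub> else None, \<lambda>i. if i \<in> {1..n} then Some i else None)\<rparr>"

text \<open>The inverse in the inverse monoid, \<open>(g;a)\<^sup>-\<^sup>1 = ((g\<^sup>-\<^sup>1)\<^bsub>a\<^sup>-\<^sup>1\<^esub>; a\<^sup>-\<^sup>1)\<close>; it gives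
  \<open>(g;a)\<^sup>-\<^sup>1(h;b) = ((g\<^sup>-\<^sup>1h)\<^bsub>a\<^sup>-\<^sup>1\<^esub>; a\<^sup>-\<^sup>1b)\<close>.\<close>

definition wr_inverse :: "('g, 'c) monoid_scheme \<Rightarrow> 'g pelem \<Rightarrow> 'g pelem"
  where "wr_inverse G = (\<lambda>(g, a). (reindex (tinv G g) (pinv a), pinv a))"

section \<open>The groups \<open>H\<^sub>e\<close> and their identification with wreath products\<close>

text \<open>The order-preserving bijection from \<open>{1..card A}\<close> onto a finite set \<open>A\<close>.\<close>

definition ord_bij :: "nat set \<Rightarrow> nat \<Rightarrow> nat"
  where "ord_bij A j = enumerate A (j - 1)"

text \<open>\<open>g\<Omega>\<close>: delete the zero entries of \<open>g\<close>.\<close>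

definition Omega :: "(nat \<Rightarrow> 'g option) \<Rightarrow> nat \<Rightarrow> 'g"
  where "Omega g = (\<lambda>j\<in>{1..card (dom g)}. the (g (ord_bij (dom g) j)))"

text \<open>For \<open>Dom(a) = Im(a)\<close> of size \<open>m\<close>, the permutation \<open>a\<gamma>\<close> of \<open>{1..m}\<close>, extended by the
  identity outside \<open>{1..m}\<close>.\<close>

definition gamma :: "(nat \<rightharpoonup> nat) \<Rightarrow> nat \<Rightarrow> nat"
  where "gamma a = (\<lambda>j. if j \<in> {1..card (dom a)}
    then inv_into {1..card (dom a)} (ord_bij (dom a)) (the (a (ord_bij (dom a) j)))
    else j)"

definition Psi :: "'g pelem \<Rightarrow> (nat \<Rightarrow> 'g) \<times> (nat \<Rightarrow> nat)"
  where "Psi = (\<lambda>(g, a). (Omega g, gamma a))"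

definition H_class :: "('g, 'c) monoid_scheme \<Rightarrow> nat \<Rightarrow> (nat \<rightharpoonup> nat) \<Rightarrow> 'g pelem set"
  where "H_class G n e = {(g, a) \<in> carrier (wreath_inv G n). dom a = dom e \<and> ran a = dom e}"

definition L_copy :: "('g, 'c) monoid_scheme \<Rightarrow> nat \<Rightarrow> ((nat \<Rightarrow> 'g) \<times> (nat \<Rightarrow> nat)) set
    \<Rightarrow> (nat \<rightharpoonup> nat) \<Rightarrow> 'g pelem set"
  where "L_copy G n L e = {x \<in> H_class G n e. Psi x \<in> L}"

section \<open>Congruences\<close>

definition congruence :: "('a, 'c) monoid_scheme \<Rightarrow> ('a \<times> 'a) set \<Rightarrow> bool"
  where "congruence M R \<longleftrightarrow> equiv (carrier M) R \<and>
    (\<forall>(x, y) \<in> R. \<forall>z \<in> carrier M. (z \<otimes>\<^bsub>M\<^esub> x, z \<otimes>\<^bsub>M\<^esub> y) \<in> R \<and> (x \<otimes>\<^bsub>M\<^esub> z, y \<otimes>\<^bsub>M\<^esub> z) \<in> R)"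

definition Rees :: "('g, 'c) monoid_scheme \<Rightarrow> nat \<Rightarrow> nat \<Rightarrow> ('g pelem \<times> 'g pelem) set"
  where "Rees G n k = Id_on (carrier (wreath_inv G n)) \<union>
    {(x, y). x \<in> carrier (wreath_inv G n) \<and> y \<in> carrier (wreath_inv G n) \<and>
             rk (snd x) \<le> k \<and> rk (snd y) \<le> k}"

definition sigma_bar :: "('g, 'c) monoid_scheme \<Rightarrow> nat \<Rightarrow> nat \<Rightarrow> ((nat \<Rightarrow> 'g) \<times> (nat \<Rightarrow> nat)) set
    \<Rightarrow> ('g pelem \<times> 'g pelem) set"
  where "sigma_bar G n m L =
    {((g, a), (h, b)). (g, a) \<in> carrier (wreath_inv G n) \<and> (h, b) \<in> carrier (wreath_inv G n) \<and>
       rk a = m \<and> rk b = m \<and> H_related a b \<and>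
       wr_inverse G (g, a) \<otimes>\<^bsub>wreath_inv G n\<^esub> (h, b) \<in> L_copy G n L (pmult (pinv a) a)}"

text \<open>In rank \<open>0\<close> there is a single element, related to itself; the value \<open>U 0\<close> is irrelevant.\<close>

definition chi :: "('g, 'c) monoid_scheme \<Rightarrow> nat \<Rightarrow> (nat \<Rightarrow> (nat \<Rightarrow> 'g) set) \<Rightarrow> ('g pelem \<times> 'g pelem) set"
  where "chi G n U =
    {((g, a), (h, b)). (g, a) \<in> carrier (wreath_inv G n) \<and> (h, b) \<in> carrier (wreath_inv G n) \<and>
       a = b \<and> (rk a = 0 \<or> Omega (tmult G (tinv G h) g) \<in> U (rk a))}"

text \<open>The sequence \<open>(G, G\<^sup>2, \<dots>, G^(m-1), T\<^bsub>m+1\<^esub>\<pi>\<^bsub>m+1\<^esub>, T\<^bsub>m+1\<^esub>, \<dots>, T\<^sub>n)\<close>, with the trivial group in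
  position \<open>m\<close> if \<open>m = n\<close>.\<close>

definition chi_seq :: "('g, 'c) monoid_scheme \<Rightarrow> nat \<Rightarrow> nat \<Rightarrow> (nat \<Rightarrow> (nat \<Rightarrow> 'g) set)
    \<Rightarrow> nat \<Rightarrow> (nat \<Rightarrow> 'g) set"
  where "chi_seq G n m T i =
    (if i < m then carrier (power_group G i)
     else if i = m then (if m = n then {\<one>\<^bsub>power_group G m\<^esub>} else proj (m + 1) ` T (m + 1))
     else T i)"

text \<open>Since \<open>m \<le> n\<close> below, \<open>rho\<close> never relates an element of rank \<open>n\<close> to one of rank \<open>0\<close>;
  hence the universal congruence (for \<open>n \<ge> 1\<close>) is not of the form \<open>rho G n m T L\<close>.\<close>

definition rho :: "('g, 'c) monoid_scheme \<Rightarrow> nat \<Rightarrow> nat \<Rightarrow> (nat \<Rightarrow> (nat \<Rightarrow> 'g) set)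
    \<Rightarrow> ((nat \<Rightarrow> 'g) \<times> (nat \<Rightarrow> nat)) set \<Rightarrow> ('g pelem \<times> 'g pelem) set"
  where "rho G n m T L = Rees G n (m - 1) \<union> sigma_bar G n m L \<union> chi G n (chi_seq G n m T)"

text \<open>The standing assumptions on the parameters \<open>m\<close>, \<open>{T\<^sub>i | m+1 \<le> i \<le> n}\<close> and \<open>L\<close>; the values of
  \<open>T\<close> outside \<open>{m+1..n}\<close> play no role.\<close>

definition congruence_data :: "('g, 'c) monoid_scheme \<Rightarrow> nat \<Rightarrow> nat \<Rightarrow> (nat \<Rightarrow> (nat \<Rightarrow> 'g) set)
    \<Rightarrow> ((nat \<Rightarrow> 'g) \<times> (nat \<Rightarrow> nat)) set \<Rightarrow> bool"
  where "congruence_data G n m T L \<longleftrightarrow>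
    1 \<le> m \<and> m \<le> n \<and>
    (\<forall>i \<in> {m + 1..n}. T i \<lhd> power_group G i \<and> perm_invariant G i (T i)) \<and>
    closed_family m n T \<and>
    L \<lhd> wreath_sym G m \<and>
    (m < n \<longrightarrow> {(t, id) | t. t \<in> proj (m + 1) ` T (m + 1)} \<subseteq> L)"

end

theory Submission
  imports Defs
begin

text \<open>
  The proof rests on one uniform description. The monoid consists of arrows between subsets
  of \<open>{1..n}\<close>, which can be composed, inverted and restricted, and the arrows from a subset \<open>A\<close> of
  size \<open>r\<close> to itself form a group isomorphic to the wreath product of \<open>G\<close> with the symmetric group
  of degree \<open>r\<close>. The isomorphism \<open>Psi\<close> is conjugation by the order-preserving arrow
  (\<open>Phi_Psi\<close>). A normal subgroup \<open>K\<close> of the wreath product therefore has a copy over every subset of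
  size \<open>r\<close>, and all arrows between such subsets permute these copies by conjugation
  (\<open>copy_conj\<close>). A permutation invariant normal subgroup \<open>T\<^sub>r\<close> of \<open>G\<^sup>r\<close> is nothing but a normal
  subgroup of the wreath product that consists of elements with trivial permutation (\<open>diag_normal\<close>,
  \<open>normal_diag\<close>), so \<open>L\<close> and the \<open>T\<^sub>r\<close> form a single sequence of normal subgroups, and
  \<open>rho\<close> becomes the relation \<open>data_rel\<close>: all elements of rank below \<open>m\<close> are related, and an
  element \<open>x\<close> of rank at least \<open>m\<close> is related to the products of \<open>x\<close> with elements of the copy over its
  image (\<open>rho_eq_data_rel\<close>).

  That this is a congruence comes down to two facts. Copies are respected by conjugation, and
  they are respected by restriction to a smaller subset, as long as its size is at least \<open>m\<close>
  (\<open>cut\<close>). The latter is what closedness of the family and the condition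
  \<open>T\<^bsub>m+1\<^esub>\<pi>\<^bsub>m+1\<^esub> \<subseteq> L\<close> express.

  Conversely, let a congruence be given that is not universal. If an element is related to one of
  smaller rank, then every element of rank at most that of the first one is related to the zero element
  (\<open>idem_descent\<close>, \<open>collapsed_if_idem\<close>). Let \<open>m\<close> be the least rank for which this fails.
  Restriction shows that related elements of rank at least \<open>m\<close> have equal domains and images, and that
  related elements of rank above \<open>m\<close> even have equal partial bijections
  (\<open>H_related_if_not_collapsed\<close>, \<open>same_shape_if_not_collapsed\<close>). Such a congruence is
  determined by the classes of the idempotents, and these yield \<open>L\<close> and the \<open>T\<^sub>r\<close>.
\<close>

\<comment> \<open>Keeps the intervals \<open>{1..r}\<close> in the form in which the definitions state them.\<close>
declare One_nat_def [simp del]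

section \<open>Arithmetic in the inverse monoid\<close>

text \<open>The element with domain \<open>A\<close> that moves \<open>A\<close> by \<open>f\<close> with all group entries trivial. Such elements
  transport questions between subsets of equal size.\<close>

definition map_elem :: "('g, 'c) monoid_scheme \<Rightarrow> nat set \<Rightarrow> (nat \<Rightarrow> nat) \<Rightarrow> 'g pelem"
  where "map_elem G A f = (\<lambda>i. if i \<in> A then Some \<one>\<^bsub>G\<^esub> else None, \<lambda>i. if i \<in> A then Some (f i) else None)"

text \<open>An element is treated as an arrow from the domain to the image of its partial bijection; the
  monoid then behaves like a groupoid whose objects are the subsets of \<open>{1..n}\<close>, together with
  the restriction of arrows to smaller subsets.\<close>

abbreviation src :: "'g pelem \<Rightarrow> nat set" where "src x \<equiv> dom (snd x)"
abbreviation tgt :: "'g pelem \<Rightarrow> nat set" where "tgt x \<equiv> ran (snd x)"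
abbreviation rank :: "'g pelem \<Rightarrow> nat" where "rank x \<equiv> card (tgt x)"

lemma bij_ord_bij: "finite A \<Longrightarrow> bij_betw (ord_bij A) {1..card A} A"
proof -
  assume A: "finite A"
  have "bij_betw (\<lambda>j. j - 1) {1..card A} {..<card A}"
    by (rule bij_betw_byWitness[where f' = Suc]) auto
  from bij_betw_trans[OF this finite_bij_enumerate[OF A]] show ?thesis
    by (rule bij_betw_cong[THEN iffD1, rotated]) (simp add: ord_bij_def)
qed

text \<open>A strictly increasing self-map of \<open>{1..r}\<close> is squeezed from both sides: counting up from \<open>1\<close> it
  cannot fall below the identity, counting down from \<open>r\<close> it cannot exceed it.\<close>

lemma ord_bij_atLeastAtMost: assumes "j \<in> {1..r}" shows "ord_bij {1..r} j = j"
proof -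
  have mem: "ord_bij {1..r} i \<in> {1..r}" if "i \<in> {1..r}" for i
    using bij_betwE[OF bij_ord_bij[of "{1..r}"]] that by simp
  have mono: "ord_bij {1..r} i < ord_bij {1..r} (Suc i)" if "1 \<le> i" "Suc i \<le> r" for i
    using that by (auto simp: ord_bij_def intro!: finite_enumerate_mono)
  have "1 \<le> j \<Longrightarrow> j \<le> r \<Longrightarrow> j \<le> ord_bij {1..r} j"
  proof (induction j rule: nat_induct_at_least)
    case base then show ?case using mem[of 1] by auto
  next
    case (Suc i) then show ?case using mono[of i] by auto
  qed
  moreover have "j \<le> r \<Longrightarrow> 1 \<le> j \<Longrightarrow> ord_bij {1..r} j \<le> j"
  proof (induction j rule: inc_induct)
    case base then show ?case using mem[of r] by auto
  next
    case (step i) then show ?case using mono[of i] by auto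
  qed
  ultimately show ?thesis using assms by auto
qed

locale partial_aut_monoid = group G for G (structure) +
  fixes n :: nat
begin

abbreviation M where "M \<equiv> wreath_inv G n"
abbreviation mprod (infixl \<open>\<odot>\<close> 70) where "x \<odot> y \<equiv> x \<otimes>\<^bsub>M\<^esub> y"
abbreviation W where "W r \<equiv> wreath_sym G r"
abbreviation iv where "iv \<equiv> wr_inverse G"

text \<open>The idempotents of the monoid, one for each subset of \<open>{1..n}\<close>. Multiplying by \<open>E A\<close> on the left
  (right) restricts an element to \<open>A\<close> in its domain (image).\<close>

definition E :: "nat set \<Rightarrow> 'a pelem"
  where "E A = (\<lambda>i. if i \<in> A then Some \<one> else None, \<lambda>i. if i \<in> A then Some i else None)"

lemmas elem_defs = E_def map_elem_def

lemma carrier_iff: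
  "x \<in> carrier M \<longleftrightarrow> dom (fst x) = src x \<and> src x \<subseteq> {1..n} \<and> tgt x \<subseteq> {1..n} \<and>
    inj_on (snd x) (src x) \<and> ran (fst x) \<subseteq> carrier G"
proof (cases x)
  case (Pair g a)
  have "dom g = dom a"
    if "dom g \<subseteq> {1..n}" "dom a \<subseteq> {1..n}" "\<forall>i\<in>{1..n}. g i \<noteq> None \<longleftrightarrow> i \<in> dom a"
    using that by (metis domIff subset_antisym subsetI subsetD)
  then show ?thesis unfolding Pair wreath_inv_def tuples0_def sym_inv_def
    by (auto simp del: atLeastAtMost_iff)
qed

lemma carrierD:
  assumes "x \<in> carrier M"
  shows "\<And>i. fst x i = None \<longleftrightarrow> snd x i = None"
    and "\<And>i c. fst x i = Some c \<Longrightarrow> c \<in> carrier G"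
    and "\<And>i j k. snd x i = Some k \<Longrightarrow> snd x j = Some k \<Longrightarrow> i = j"
    and "src x \<subseteq> {1..n}" and "tgt x \<subseteq> {1..n}" and "finite (src x)" and "finite (tgt x)"
proof -
  from assms have *: "dom (fst x) = src x" "src x \<subseteq> {1..n}" "tgt x \<subseteq> {1..n}"
    "inj_on (snd x) (src x)" "ran (fst x) \<subseteq> carrier G" unfolding carrier_iff by auto
  then show "\<And>i. fst x i = None \<longleftrightarrow> snd x i = None" by (metis domIff)
  show "\<And>i c. fst x i = Some c \<Longrightarrow> c \<in> carrier G" using *(5) by (auto simp: ran_def)
  show "\<And>i j k. snd x i = Some k \<Longrightarrow> snd x j = Some k \<Longrightarrow> i = j"
    using *(4) by (metis domI inj_onD)
  show "src x \<subseteq> {1..n}" "tgt x \<subseteq> {1..n}" by fact+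
  show "finite (src x)" "finite (tgt x)" using *(2,3) finite_subset by blast+
qed

lemma carrierI:
  assumes "\<And>i. fst x i = None \<longleftrightarrow> snd x i = None"
    and "\<And>i c. fst x i = Some c \<Longrightarrow> c \<in> carrier G"
    and "\<And>i j k. snd x i = Some k \<Longrightarrow> snd x j = Some k \<Longrightarrow> i = j"
    and "src x \<subseteq> {1..n}" and "tgt x \<subseteq> {1..n}"
  shows "x \<in> carrier M"
proof -
  have "inj_on (snd x) (src x)" using assms(3) by (fastforce simp: inj_on_def)
  moreover have "dom (fst x) = src x" using assms(1) by (auto simp: dom_def)
  ultimately show ?thesis using assms(2,4,5) unfolding carrier_iff by (auto simp: ran_def)
qed

lemma snd_mult: "snd (x \<odot> y) i = (case snd x i of None \<Rightarrow> None | Some j \<Rightarrow> snd y j)"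
  by (cases x; cases y) (simp add: wreath_inv_def pmult_def map_comp_def split: option.split)

lemma fst_mult: "fst (x \<odot> y) i =
    (case snd x i of None \<Rightarrow> mult0 G (fst x i) None | Some j \<Rightarrow> mult0 G (fst x i) (fst y j))"
  by (cases x; cases y) (simp add: wreath_inv_def tmult_def reindex_def map_comp_def split: option.split)

lemma mult0_None [simp]: "mult0 G a None = None"
  by (cases a) auto

lemma mult0_eq_None: "mult0 G a b = None \<longleftrightarrow> a = None \<or> b = None"
  by (cases a; cases b) auto

lemma src_mult: "src (x \<odot> y) = {i. \<exists>j. snd x i = Some j \<and> j \<in> src y}"
  by (auto simp: dom_def snd_mult split: option.splits)

lemma tgt_mult: "tgt (x \<odot> y) = {k. \<exists>j \<in> tgt x. snd y j = Some k}"
  by (auto simp: ran_def snd_mult split: option.splits)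

lemma elem_eqI: "(\<And>i. fst x i = fst y i) \<Longrightarrow> (\<And>i. snd x i = snd y i) \<Longrightarrow> x = y"
  for x y :: "'a pelem"
  by (auto simp: prod_eq_iff)

lemma mult_closed: assumes x: "x \<in> carrier M" and y: "y \<in> carrier M" shows "x \<odot> y \<in> carrier M"
proof (rule carrierI)
  note X = carrierD[OF x] and Y = carrierD[OF y]
  show "fst (x \<odot> y) i = None \<longleftrightarrow> snd (x \<odot> y) i = None" for i
    using X(1)[of i] Y(1) by (auto simp: fst_mult snd_mult mult0_eq_None split: option.splits)
  show "c \<in> carrier G" if "fst (x \<odot> y) i = Some c" for i c
    using that X(2)[of i] Y(2)
    by (auto simp: fst_mult elim!: mult0.elims split: option.splits)
  show "i = j" if "snd (x \<odot> y) i = Some k" "snd (x \<odot> y) j = Some k" for i j k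
    using that X(3) Y(3) by (fastforce simp: snd_mult split: option.splits)
  show "src (x \<odot> y) \<subseteq> {1..n}" using X(4) by (auto simp: src_mult)
  show "tgt (x \<odot> y) \<subseteq> {1..n}" using Y(5) by (auto simp: tgt_mult intro: ranI)
qed

lemma map_elem_closed:
  assumes "A \<subseteq> {1..n}" "inj_on f A" "f ` A \<subseteq> {1..n}"
  shows "map_elem G A f \<in> carrier M"
  using assms by (intro carrierI) (auto simp: elem_defs ran_def inj_on_def split: if_splits)

lemma src_map_elem [simp]: "src (map_elem G A f) = A"
  by (auto simp: elem_defs dom_def)

lemma tgt_map_elem [simp]: "tgt (map_elem G A f) = f ` A"
  by (auto simp: elem_defs ran_def)

lemma src_E [simp]: "src (E A) = A"
  by (auto simp: E_def dom_def)

lemma tgt_E [simp]: "tgt (E A) = A"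
  by (auto simp: E_def ran_def)

lemma E_closed: "A \<subseteq> {1..n} \<Longrightarrow> E A \<in> carrier M"
  by (intro carrierI) (auto simp: E_def ran_def split: if_splits)

lemma E_mult_left: assumes "x \<in> carrier M"
  shows "E A \<odot> x = (\<lambda>i. if i \<in> A then fst x i else None, \<lambda>i. if i \<in> A then snd x i else None)"
proof (rule elem_eqI)
  fix i
  have "mult0 G (Some \<one>) (fst x i) = fst x i"
    using carrierD(2)[OF assms, of i] by (cases "fst x i") auto
  then show "fst (E A \<odot> x) i = fst (\<lambda>i. if i \<in> A then fst x i else None, \<lambda>i. if i \<in> A then snd x i else None) i"
    by (simp add: fst_mult E_def)
  show "snd (E A \<odot> x) i = snd (\<lambda>i. if i \<in> A then fst x i else None, \<lambda>i. if i \<in> A then snd x i else None) i"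
    by (simp add: snd_mult E_def)
qed

lemma E_left: "x \<in> carrier M \<Longrightarrow> src x \<subseteq> A \<Longrightarrow> E A \<odot> x = x"
proof (rule elem_eqI)
  fix i
  assume x: "x \<in> carrier M" and A: "src x \<subseteq> A"
  have "fst x i = None \<and> snd x i = None" if "i \<notin> A"
    using that A carrierD(1)[OF x, of i] by (auto simp: domIff subset_iff)
  then show "fst (E A \<odot> x) i = fst x i" "snd (E A \<odot> x) i = snd x i"
    using x by (auto simp: E_mult_left)
qed

lemma E_right: assumes "x \<in> carrier M" "tgt x \<subseteq> A" shows "x \<odot> E A = x"
proof (rule elem_eqI)
  fix i
  have *: "snd x i = Some j \<Longrightarrow> j \<in> A" for j using assms(2) by (auto simp: ran_def)
  show "snd (x \<odot> E A) i = snd x i"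
    using * by (auto simp: snd_mult elem_defs split: option.splits)
  show "fst (x \<odot> E A) i = fst x i"
    using * carrierD(1,2)[OF assms(1), of i] by (cases "fst x i") (auto simp: fst_mult elem_defs split: option.splits)
qed

lemma mult_assoc: assumes x: "x \<in> carrier M" and y: "y \<in> carrier M" and z: "z \<in> carrier M"
  shows "x \<odot> y \<odot> z = x \<odot> (y \<odot> z)"
proof (rule elem_eqI)
  fix i
  show "snd (x \<odot> y \<odot> z) i = snd (x \<odot> (y \<odot> z)) i"
    by (auto simp: snd_mult split: option.splits)
  have a: "mult0 G (mult0 G a b) c = mult0 G a (mult0 G b c)"
    if "set_option a \<subseteq> carrier G" "set_option b \<subseteq> carrier G" "set_option c \<subseteq> carrier G" for a b c
    using that by (cases a; cases b; cases c) (auto simp: m_assoc)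
  have *: "set_option (fst x i) \<subseteq> carrier G" "set_option (fst y i) \<subseteq> carrier G" "set_option (fst z i) \<subseteq> carrier G" for i
    using carrierD(2)[OF x] carrierD(2)[OF y] carrierD(2)[OF z] by auto
  show "fst (x \<odot> y \<odot> z) i = fst (x \<odot> (y \<odot> z)) i"
    using a * by (auto simp: snd_mult fst_mult split: option.splits)
qed

lemma pinv_Some_iff:
  assumes "x \<in> carrier M" shows "pinv (snd x) j = Some i \<longleftrightarrow> snd x i = Some j"
proof
  assume "snd x i = Some j"
  moreover from this have "(THE i. snd x i = Some j) = i" using carrierD(3)[OF assms] by blast
  ultimately show "pinv (snd x) j = Some i" by (auto simp: pinv_def ran_def)
next
  assume "pinv (snd x) j = Some i"
  then obtain i' where i': "snd x i' = Some j" and i: "(THE i. snd x i = Some j) = i"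
    by (auto simp: pinv_def ran_def split: if_splits)
  moreover have "(THE i. snd x i = Some j) = i'" using i' carrierD(3)[OF assms] by blast
  ultimately show "snd x i = Some j" by simp
qed

lemma snd_iv: "x \<in> carrier M \<Longrightarrow> snd (iv x) j = Some i \<longleftrightarrow> snd x i = Some j"
  using pinv_Some_iff[of x] by (cases x) (simp add: wr_inverse_def)

lemma fst_iv: "fst (iv x) j = (case snd (iv x) j of None \<Rightarrow> None | Some i \<Rightarrow> map_option (m_inv G) (fst x i))"
  by (cases x) (simp add: wr_inverse_def reindex_def map_comp_def tinv_def split: option.split)

lemma src_iv [simp]: "x \<in> carrier M \<Longrightarrow> src (iv x) = tgt x"
  using snd_iv[of x] by (auto simp: dom_def ran_def)

lemma tgt_iv [simp]: "x \<in> carrier M \<Longrightarrow> tgt (iv x) = src x"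
  using snd_iv[of x] by (auto simp: dom_def ran_def)

lemma iv_closed: assumes x: "x \<in> carrier M" shows "iv x \<in> carrier M"
proof (rule carrierI)
  note X = carrierD[OF x]
  show "fst (iv x) i = None \<longleftrightarrow> snd (iv x) i = None" for i
    using X(1) snd_iv[OF x] by (auto simp: fst_iv split: option.splits)
  show "c \<in> carrier G" if "fst (iv x) i = Some c" for i c
    using that X(2) by (auto simp: fst_iv split: option.splits)
  show "i = j" if "snd (iv x) i = Some k" "snd (iv x) j = Some k" for i j k
    using that snd_iv[OF x] by auto
qed (use x carrierD[OF x] in auto)

lemma iv_right: assumes x: "x \<in> carrier M" shows "x \<odot> iv x = E (src x)"
proof (rule elem_eqI)
  fix i
  note X = carrierD[OF x]
  show "snd (x \<odot> iv x) i = snd (E (src x)) i"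
    using snd_iv[OF x] by (cases "snd x i") (auto simp: snd_mult elem_defs)
  show "fst (x \<odot> iv x) i = fst (E (src x)) i"
  proof (cases "snd x i")
    case None then show ?thesis by (auto simp: fst_mult elem_defs)
  next
    case (Some j)
    then have "snd (iv x) j = Some i" using snd_iv[OF x] by simp
    moreover obtain c where "fst x i = Some c" "c \<in> carrier G" using Some X(1,2) by (cases "fst x i") auto
    ultimately show ?thesis using Some by (auto simp: fst_mult fst_iv elem_defs)
  qed
qed

lemma iv_left: assumes x: "x \<in> carrier M" shows "iv x \<odot> x = E (tgt x)"
proof (rule elem_eqI)
  fix j
  note X = carrierD[OF x]
  show "snd (iv x \<odot> x) j = snd (E (tgt x)) j"
  proof (cases "snd (iv x) j")
    case None
    then have "j \<notin> tgt x" using src_iv[OF x] by blast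
    with None show ?thesis by (simp add: snd_mult elem_defs)
  next
    case (Some i)
    then have "snd x i = Some j" "j \<in> tgt x" using snd_iv[OF x] by (auto simp: ran_def)
    with Some show ?thesis by (simp add: snd_mult elem_defs)
  qed
  show "fst (iv x \<odot> x) j = fst (E (tgt x)) j"
  proof (cases "snd (iv x) j")
    case None
    then have "j \<notin> tgt x" using src_iv[OF x] by blast
    with None show ?thesis by (simp add: fst_mult fst_iv elem_defs)
  next
    case (Some i)
    then have "snd x i = Some j" using snd_iv[OF x] by simp
    moreover from this obtain c where "fst x i = Some c" "c \<in> carrier G" using X(1,2) by (cases "fst x i") auto
    ultimately show ?thesis using Some by (auto simp: fst_mult fst_iv elem_defs ran_def)
  qed
qed

lemma bij_src_tgt: assumes "x \<in> carrier M" shows "bij_betw (\<lambda>i. the (snd x i)) (src x) (tgt x)"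
proof (rule bij_betw_imageI)
  show "inj_on (\<lambda>i. the (snd x i)) (src x)"
    using carrierD(3)[OF assms] by (intro inj_onI) (auto simp: dom_def)
  show "(\<lambda>i. the (snd x i)) ` src x = tgt x"
    by (auto simp: ran_def dom_def image_iff) (metis option.sel)
qed

lemma rank_src: "x \<in> carrier M \<Longrightarrow> rank x = card (src x)"
  using bij_betw_same_card[OF bij_src_tgt] by simp

lemma rank_mult: assumes "x \<in> carrier M" "y \<in> carrier M" shows "rank (x \<odot> y) = card (tgt x \<inter> src y)"
proof -
  have "bij_betw (\<lambda>i. the (snd y i)) (tgt x \<inter> src y) (tgt (x \<odot> y))"
  proof (rule bij_betw_imageI)
    show "inj_on (\<lambda>i. the (snd y i)) (tgt x \<inter> src y)"
      using carrierD(3)[OF assms(2)] by (intro inj_onI) (auto simp: dom_def)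
    show "(\<lambda>i. the (snd y i)) ` (tgt x \<inter> src y) = tgt (x \<odot> y)"
      unfolding tgt_mult by (force simp: dom_def image_iff)
  qed
  from bij_betw_same_card[OF this] show ?thesis by simp
qed

lemma src_E_mult: "src (E A \<odot> x) = A \<inter> src x"
  by (auto simp: src_mult elem_defs split: if_splits)

lemma E_mult_E: "E A \<odot> E B = E (A \<inter> B)"
  by (rule elem_eqI) (auto simp: snd_mult fst_mult elem_defs)

lemma iv_cancel_left: "z \<in> carrier M \<Longrightarrow> x \<in> carrier M \<Longrightarrow> src x \<subseteq> tgt z \<Longrightarrow> iv z \<odot> (z \<odot> x) = x"
  by (simp add: mult_assoc[symmetric] iv_closed iv_left E_left)

lemma iv_cancel_left': "z \<in> carrier M \<Longrightarrow> x \<in> carrier M \<Longrightarrow> src x \<subseteq> src z \<Longrightarrow> z \<odot> (iv z \<odot> x) = x"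
  by (simp add: mult_assoc[symmetric] iv_closed iv_right E_left)

lemma src_mult_le: "src x \<subseteq> A \<Longrightarrow> src (x \<odot> y) \<subseteq> A"
  by (auto simp: src_mult)

lemma tgt_mult_le: "tgt y \<subseteq> A \<Longrightarrow> tgt (x \<odot> y) \<subseteq> A"
  by (auto simp: tgt_mult intro: ranI)

lemma src_mult_eq: assumes "tgt x \<subseteq> src y" shows "src (x \<odot> y) = src x"
  using assms by (auto simp: src_mult subset_iff ranI)

lemma tgt_mult_eq: assumes "src y \<subseteq> tgt x" shows "tgt (x \<odot> y) = tgt y"
proof
  show "tgt (x \<odot> y) \<subseteq> tgt y" by (rule tgt_mult_le) simp
  show "tgt y \<subseteq> tgt (x \<odot> y)"
  proof
    fix k assume "k \<in> tgt y"
    then obtain j where "snd y j = Some k" by (auto simp: ran_def)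
    moreover from this have "j \<in> tgt x" using assms by blast
    ultimately show "k \<in> tgt (x \<odot> y)" by (auto simp: tgt_mult)
  qed
qed

section \<open>Maximal subgroups and wreath products\<close>

text \<open>The maximal subgroup at the idempotent \<open>E A\<close>; it depends on the idempotent only through
  its domain, so it is indexed by the subset.\<close>

definition H_grp :: "nat set \<Rightarrow> 'a pelem set"
  where "H_grp A = {x \<in> carrier M. src x = A \<and> tgt x = A}"

lemma H_grpD: "x \<in> H_grp A \<Longrightarrow> x \<in> carrier M" "x \<in> H_grp A \<Longrightarrow> src x = A" "x \<in> H_grp A \<Longrightarrow> tgt x = A"
  by (auto simp: H_grp_def)

lemma H_grp_subset: "x \<in> H_grp A \<Longrightarrow> A \<subseteq> {1..n}"
  using carrierD(4)[of x] by (simp add: H_grp_def)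

lemma H_grp_mult: "x \<in> H_grp A \<Longrightarrow> y \<in> H_grp A \<Longrightarrow> x \<odot> y \<in> H_grp A"
  by (simp add: H_grp_def mult_closed src_mult_eq tgt_mult_eq)

lemma H_grp_iv: "x \<in> H_grp A \<Longrightarrow> iv x \<in> H_grp A"
  by (simp add: H_grp_def iv_closed)

lemma H_grp_E: "A \<subseteq> {1..n} \<Longrightarrow> E A \<in> H_grp A"
  by (simp add: H_grp_def E_closed)

lemma H_grp_conj: "z \<in> carrier M \<Longrightarrow> u \<in> H_grp (src z) \<Longrightarrow> iv z \<odot> u \<odot> z \<in> H_grp (tgt z)"
  by (simp add: H_grp_def iv_closed mult_closed src_mult_eq tgt_mult_eq)

lemma W_iff: "p \<in> carrier (W r) \<longleftrightarrow> fst p \<in> {1..r} \<rightarrow>\<^sub>E carrier G \<and> snd p permutes {1..r}"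
  by (cases p) (simp add: wreath_sym_def power_group_def)

lemma W_mult: "p \<otimes>\<^bsub>W r\<^esub> q = (\<lambda>i\<in>{1..r}. fst p i \<otimes> fst q (snd p i), snd q \<circ> snd p)"
  by (cases p; cases q) (auto simp: wreath_sym_def power_group_def fun_eq_iff)

lemma W_one: "\<one>\<^bsub>W r\<^esub> = (\<lambda>i\<in>{1..r}. \<one>, id)"
  by (simp add: wreath_sym_def power_group_def)

lemma W_closed: assumes "p \<in> carrier (W r)" "q \<in> carrier (W r)" shows "p \<otimes>\<^bsub>W r\<^esub> q \<in> carrier (W r)"
proof -
  have "snd p i \<in> {1..r}" if "i \<in> {1..r}" for i
    using assms(1) that permutes_in_image unfolding W_iff by metis
  then show ?thesis using assms unfolding W_iff W_mult by (auto intro!: permutes_compose simp: PiE_iff)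
qed

text \<open>The inverse of \<open>Psi\<close> over the initial segment \<open>{1..r}\<close>. Because it is a plain reading of tuples
  and permutations as partial functions, it is visibly multiplicative and injective, and facts about
  the wreath product are deduced from facts about the inverse monoid through it.\<close>

definition Phi :: "nat \<Rightarrow> (nat \<Rightarrow> 'a) \<times> (nat \<Rightarrow> nat) \<Rightarrow> 'a pelem"
  where "Phi r p = (\<lambda>i. if i \<in> {1..r} then Some (fst p i) else None,
                    \<lambda>i. if i \<in> {1..r} then Some (snd p i) else None)"

lemma Phi_H_grp: assumes "r \<le> n" "p \<in> carrier (W r)" shows "Phi r p \<in> H_grp {1..r}"
proof -
  have P: "fst p \<in> {1..r} \<rightarrow>\<^sub>E carrier G" "snd p permutes {1..r}" using assms(2) unfolding W_iff by auto
  have src: "src (Phi r p) = {1..r}" by (auto simp: Phi_def dom_def)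
  have "tgt (Phi r p) = snd p ` {1..r}" by (auto simp: Phi_def ran_def)
  then have tgt: "tgt (Phi r p) = {1..r}" using permutes_image[OF P(2)] by simp
  have "Phi r p \<in> carrier M"
  proof (rule carrierI)
    show "i = j" if "snd (Phi r p) i = Some k" "snd (Phi r p) j = Some k" for i j k
      using that injD[OF permutes_inj[OF P(2)]] by (auto simp: Phi_def split: if_splits)
    show "c \<in> carrier G" if "fst (Phi r p) i = Some c" for i c
      using that P(1) by (auto simp: Phi_def split: if_splits)
  qed (use src tgt assms(1) in \<open>auto simp: Phi_def\<close>)
  with src tgt show ?thesis by (simp add: H_grp_def)
qed

lemma Phi_mult: assumes "p \<in> carrier (W r)" shows "Phi r (p \<otimes>\<^bsub>W r\<^esub> q) = Phi r p \<odot> Phi r q"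
proof (rule elem_eqI)
  fix i
  have "snd p i \<in> {1..r}" if "i \<in> {1..r}"
    using assms that permutes_in_image unfolding W_iff by metis
  then show "fst (Phi r (p \<otimes>\<^bsub>W r\<^esub> q)) i = fst (Phi r p \<odot> Phi r q) i"
    "snd (Phi r (p \<otimes>\<^bsub>W r\<^esub> q)) i = snd (Phi r p \<odot> Phi r q) i"
    by (auto simp: Phi_def W_mult fst_mult snd_mult)
qed

lemma Phi_one: "Phi r \<one>\<^bsub>W r\<^esub> = E {1..r}"
  by (simp add: W_one Phi_def elem_defs fun_eq_iff)

lemma Phi_inj: assumes p: "p \<in> carrier (W r)" and q: "q \<in> carrier (W r)" and eq: "Phi r p = Phi r q" shows "p = q"
proof -
  have *: "fst p i = fst q i" "snd p i = snd q i" if "i \<in> {1..r}" for i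
    using arg_cong[OF eq, of "\<lambda>x. fst x i"] arg_cong[OF eq, of "\<lambda>x. snd x i"] that
    by (simp_all add: Phi_def)
  have "fst p = fst q"
    using p q * by (intro PiE_ext[of _ "{1..r}" "\<lambda>_. carrier G"]) (auto simp: W_iff simp del: atLeastAtMost_iff)
  moreover have "snd p = snd q"
  proof
    fix i
    have "snd p permutes {1..r}" "snd q permutes {1..r}" using p q by (auto simp: W_iff)
    then show "snd p i = snd q i"
      using *(2)[of i] by (cases "i \<in> {1..r}") (simp_all add: permutes_not_in)
  qed
  ultimately show ?thesis by (simp add: prod_eq_iff)
qed

definition theta :: "nat set \<Rightarrow> 'a pelem"
  where "theta A = map_elem G {1..card A} (ord_bij A)"

lemma theta: assumes "A \<subseteq> {1..n}"
  shows "theta A \<in> carrier M" "src (theta A) = {1..card A}" "tgt (theta A) = A"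
proof -
  have *: "bij_betw (ord_bij A) {1..card A} A"
    using bij_ord_bij finite_subset[OF assms] by blast
  have "card A \<le> n" using card_mono[OF _ assms] by simp
  then show "theta A \<in> carrier M" unfolding theta_def
    using * assms by (intro map_elem_closed) (auto simp: bij_betw_def)
  show "src (theta A) = {1..card A}" "tgt (theta A) = A"
    using * by (auto simp: theta_def bij_betw_def)
qed

lemma theta_interval: "r \<le> n \<Longrightarrow> theta {1..r} = E {1..r}"
  using ord_bij_atLeastAtMost[of _ r] by (auto simp: theta_def elem_defs fun_eq_iff simp del: atLeastAtMost_iff)

lemma Psi_closed: assumes x: "x \<in> H_grp A" shows "Psi x \<in> carrier (W (card A))"
proof -
  note X = carrierD[OF H_grpD(1)[OF x]]
  have th: "bij_betw (ord_bij A) {1..card A} A"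
    using bij_ord_bij finite_subset[OF H_grp_subset[OF x]] by blast
  have dom: "dom (fst x) = A" "dom (snd x) = A" using X(1) H_grpD[OF x] by (auto simp: dom_def)
  have a: "bij_betw (\<lambda>i. the (snd x i)) A A" using bij_src_tgt[OF H_grpD(1)[OF x]] H_grpD[OF x] by simp
  have "bij_betw (inv_into {1..card A} (ord_bij A) \<circ> (\<lambda>i. the (snd x i)) \<circ> ord_bij A) {1..card A} {1..card A}"
    by (rule bij_betw_trans[OF th bij_betw_trans[OF a bij_betw_inv_into[OF th]], unfolded comp_assoc[symmetric]])
  then have "bij_betw (gamma (snd x)) {1..card A} {1..card A}"
    by (rule bij_betw_cong[THEN iffD1, rotated]) (simp add: gamma_def dom)
  then have "gamma (snd x) permutes {1..card A}"
    by (rule bij_imp_permutes) (auto simp: gamma_def dom)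
  moreover have "Omega (fst x) \<in> {1..card A} \<rightarrow>\<^sub>E carrier G"
  proof -
    have "the (fst x (ord_bij A j)) \<in> carrier G" if "j \<in> {1..card A}" for j
    proof -
      have "ord_bij A j \<in> dom (fst x)" using bij_betwE[OF th] that dom by blast
      then show ?thesis using X(2) by auto
    qed
    then show ?thesis by (auto simp: Omega_def dom)
  qed
  ultimately show ?thesis by (cases x) (simp add: W_iff Psi_def)
qed

text \<open>The identification \<open>Psi\<close> is conjugation by the order-preserving arrow. This replaces every
  computation with enumerations and deleted zero entries by cancellation in the inverse monoid.\<close>

lemma Phi_Psi: assumes x: "x \<in> H_grp A"
  shows "Phi (card A) (Psi x) = theta A \<odot> x \<odot> iv (theta A)"
proof (rule elem_eqI)
  note X = carrierD[OF H_grpD(1)[OF x]]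
  note T = theta[OF H_grp_subset[OF x]]
  have th: "bij_betw (ord_bij A) {1..card A} A"
    using bij_ord_bij finite_subset[OF H_grp_subset[OF x]] by blast
  have dom: "dom (fst x) = A" "dom (snd x) = A" using X(1) H_grpD[OF x] by (auto simp: dom_def)
  have xe: "x = (fst x, snd x)" by simp
  fix i
  have "fst (Phi (card A) (Psi x)) i = fst (theta A \<odot> x \<odot> iv (theta A)) i \<and>
    snd (Phi (card A) (Psi x)) i = snd (theta A \<odot> x \<odot> iv (theta A)) i"
  proof (cases "i \<in> {1..card A}")
    case False
    then have "snd (theta A) i = None" "fst (theta A) i = None" by (auto simp: theta_def elem_defs)
    then show ?thesis using False by (auto simp: Phi_def fst_mult snd_mult)
  next
    case i: True
    define j where "j = ord_bij A i"
    have j: "j \<in> A" using bij_betwE[OF th] i by (auto simp: j_def)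
    then obtain k where k: "snd x j = Some k" using dom by blast
    obtain c where c: "fst x j = Some c" using j dom by blast
    have cG: "c \<in> carrier G" using X(2) c by blast
    have kA: "k \<in> A" using k H_grpD(3)[OF x] by (auto simp: ran_def)
    define l where "l = inv_into {1..card A} (ord_bij A) k"
    have l: "l \<in> {1..card A}" "ord_bij A l = k"
      using kA th unfolding l_def bij_betw_def by (metis inv_into_into, metis f_inv_into_f)
    have "snd (theta A) l = Some k" using l by (simp add: theta_def elem_defs)
    then have ivk: "snd (iv (theta A)) k = Some l" using snd_iv[OF T(1)] by simp
    have thi: "snd (theta A) i = Some j" "fst (theta A) i = Some \<one>" using i by (auto simp: theta_def elem_defs j_def)
    have thl: "fst (theta A) l = Some \<one>" using l by (simp add: theta_def elem_defs)
    have R: "snd (theta A \<odot> x \<odot> iv (theta A)) i = Some l" "fst (theta A \<odot> x \<odot> iv (theta A)) i = Some c"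
      using thi thl ivk k c cG by (auto simp: snd_mult fst_mult fst_iv)
    have "fst (Psi x) i = c" "snd (Psi x) i = l"
      using i c k dom by (auto simp: Psi_def case_prod_beta Omega_def gamma_def j_def[symmetric] l_def)
    then show ?thesis using R i by (simp add: Phi_def)
  qed
  then show "fst (Phi (card A) (Psi x)) i = fst (theta A \<odot> x \<odot> iv (theta A)) i"
    "snd (Phi (card A) (Psi x)) i = snd (theta A \<odot> x \<odot> iv (theta A)) i" by auto
qed

lemma iv_E: assumes "A \<subseteq> {1..n}" shows "iv (E A) = E A"
proof -
  have "E A \<odot> (iv (E A) \<odot> E A) = E A" using iv_cancel_left'[of "E A" "E A"] assms by (simp add: E_closed)
  moreover have "E A \<odot> (iv (E A) \<odot> E A) = iv (E A)"
    using assms by (simp add: E_left E_right E_closed iv_closed)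
  ultimately show ?thesis by simp
qed

lemma Phi_Psi_interval: assumes r: "r \<le> n" and x: "x \<in> H_grp {1..r}" shows "Phi r (Psi x) = x"
proof -
  have "{1..r} \<subseteq> {1..n}" using r by simp
  moreover have "Phi r (Psi x) = theta {1..r} \<odot> x \<odot> iv (theta {1..r})"
    using Phi_Psi[OF x] by simp
  ultimately show ?thesis
    unfolding theta_interval[OF r] using H_grpD[OF x] by (simp only: iv_E) (simp add: E_left E_right)
qed

lemma Psi_Phi: assumes "r \<le> n" "p \<in> carrier (W r)" shows "Psi (Phi r p) = p"
proof (rule Phi_inj)
  show "Phi r (Psi (Phi r p)) = Phi r p" by (rule Phi_Psi_interval[OF assms(1) Phi_H_grp[OF assms]])
  show "Psi (Phi r p) \<in> carrier (W r)" using Psi_closed[OF Phi_H_grp[OF assms]] by simp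
qed fact

text \<open>The group laws are inherited from the maximal subgroup over \<open>{1..r}\<close> through the
  injection \<open>Phi\<close>.\<close>

lemma group_W: assumes r: "r \<le> n" shows "group (W r)"
proof (rule groupI)
  show one: "\<one>\<^bsub>W r\<^esub> \<in> carrier (W r)" using permutes_id by (simp add: W_one W_iff)
  note P = H_grpD[OF Phi_H_grp[OF r]]
  fix x y z assume x: "x \<in> carrier (W r)" and y: "y \<in> carrier (W r)" and z: "z \<in> carrier (W r)"
  show "x \<otimes>\<^bsub>W r\<^esub> y \<in> carrier (W r)" by (rule W_closed[OF x y])
  have "Phi r (x \<otimes>\<^bsub>W r\<^esub> y \<otimes>\<^bsub>W r\<^esub> z) = Phi r (x \<otimes>\<^bsub>W r\<^esub> (y \<otimes>\<^bsub>W r\<^esub> z))"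
    by (simp add: x y z P(1) W_closed Phi_mult mult_assoc)
  then show "x \<otimes>\<^bsub>W r\<^esub> y \<otimes>\<^bsub>W r\<^esub> z = x \<otimes>\<^bsub>W r\<^esub> (y \<otimes>\<^bsub>W r\<^esub> z)"
    by (rule Phi_inj[rotated 2]) (intro W_closed x y z)+
  have "Phi r (\<one>\<^bsub>W r\<^esub> \<otimes>\<^bsub>W r\<^esub> x) = Phi r x"
    by (simp add: x one P W_closed Phi_mult Phi_one E_left)
  then show "\<one>\<^bsub>W r\<^esub> \<otimes>\<^bsub>W r\<^esub> x = x"
    by (rule Phi_inj[rotated 2]) (intro W_closed x one)+
  have h: "iv (Phi r x) \<in> H_grp {1..r}" using H_grp_iv[OF Phi_H_grp[OF r x]] .
  have c: "Psi (iv (Phi r x)) \<in> carrier (W r)" using Psi_closed[OF h] by simp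
  have "Phi r (Psi (iv (Phi r x)) \<otimes>\<^bsub>W r\<^esub> x) = Phi r \<one>\<^bsub>W r\<^esub>"
    by (simp add: x c Phi_mult Phi_one Phi_Psi_interval[OF r h] iv_left P)
  then have "Psi (iv (Phi r x)) \<otimes>\<^bsub>W r\<^esub> x = \<one>\<^bsub>W r\<^esub>"
    by (rule Phi_inj[rotated 2]) (intro W_closed x one c)+
  with c show "\<exists>y\<in>carrier (W r). y \<otimes>\<^bsub>W r\<^esub> x = \<one>\<^bsub>W r\<^esub>" by blast
qed

lemma Psi_mult: assumes x: "x \<in> H_grp A" and y: "y \<in> H_grp A"
  shows "Psi (x \<odot> y) = Psi x \<otimes>\<^bsub>W (card A)\<^esub> Psi y"
proof (rule Phi_inj)
  note T = theta[OF H_grp_subset[OF x]]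
  show "Phi (card A) (Psi (x \<odot> y)) = Phi (card A) (Psi x \<otimes>\<^bsub>W (card A)\<^esub> Psi y)"
    using T H_grpD[OF x] H_grpD[OF y]
    by (simp add: Phi_mult Psi_closed[OF x] Phi_Psi[OF x] Phi_Psi[OF y] Phi_Psi[OF H_grp_mult[OF x y]]
        mult_assoc mult_closed iv_closed iv_cancel_left src_mult_le)
qed (intro Psi_closed W_closed H_grp_mult x y)+

lemma Psi_E: assumes "A \<subseteq> {1..n}" shows "Psi (E A) = \<one>\<^bsub>W (card A)\<^esub>"
proof (rule Phi_inj)
  have r: "card A \<le> n" using card_mono[OF _ assms] by simp
  show "\<one>\<^bsub>W (card A)\<^esub> \<in> carrier (W (card A))" using group_W[OF r] by (simp add: group.is_monoid)
  show "Phi (card A) (Psi (E A)) = Phi (card A) \<one>\<^bsub>W (card A)\<^esub>"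
    using theta[OF assms] by (simp add: Phi_Psi[OF H_grp_E[OF assms]] Phi_one E_right iv_right)
qed (intro Psi_closed H_grp_E assms)

lemma Psi_iv: assumes x: "x \<in> H_grp A" shows "Psi (iv x) = inv\<^bsub>W (card A)\<^esub> (Psi x)"
proof -
  have s: "A \<subseteq> {1..n}" by (rule H_grp_subset[OF x])
  then have r: "card A \<le> n" using card_mono[OF _ s] by simp
  have "Psi (iv x) \<otimes>\<^bsub>W (card A)\<^esub> Psi x = \<one>\<^bsub>W (card A)\<^esub>"
    using iv_left[OF H_grpD(1)[OF x]] H_grpD[OF x] s
    by (simp add: Psi_mult[OF H_grp_iv[OF x] x, symmetric] Psi_E)
  then show ?thesis 
    by (intro group.inv_equality[OF group_W[OF r], symmetric] Psi_closed x H_grp_iv)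
qed

section \<open>Copies of a normal subgroup over arbitrary subsets\<close>

text \<open>For an idempotent \<open>e\<close> with domain \<open>A\<close> and \<open>K = L\<close> this is the set \<open>L\<^sub>e\<close>; the same
  construction is needed for the groups \<open>T\<^sub>i\<close>.\<close>

definition copy :: "((nat \<Rightarrow> 'a) \<times> (nat \<Rightarrow> nat)) set \<Rightarrow> nat set \<Rightarrow> 'a pelem set"
  where "copy K A = {u \<in> H_grp A. Psi u \<in> K}"

lemma copy_H_grp: "u \<in> copy K A \<Longrightarrow> u \<in> H_grp A" by (simp add: copy_def)

context
  fixes K A
  assumes K: "K \<lhd> W (card A)" and A: "A \<subseteq> {1..n}"
begin

lemma subgroup_K: "subgroup K (W (card A))" using K by (rule normal_imp_subgroup)

lemma copy_E: "E A \<in> copy K A"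
  using H_grp_E[OF A] Psi_E[OF A] subgroup.one_closed[OF subgroup_K] by (simp add: copy_def)

lemma copy_mult: "u \<in> copy K A \<Longrightarrow> v \<in> copy K A \<Longrightarrow> u \<odot> v \<in> copy K A"
  by (auto simp: copy_def H_grp_mult Psi_mult intro: subgroup.m_closed[OF subgroup_K])

lemma copy_iv: "u \<in> copy K A \<Longrightarrow> iv u \<in> copy K A"
  by (auto simp: copy_def H_grp_iv Psi_iv intro: subgroup.m_inv_closed[OF subgroup_K])

text \<open>Normality of \<open>K\<close> makes its copies independent of the way in which the subsets are identified:
  any arrow \<open>z\<close> from \<open>A\<close> to \<open>B\<close>, not just the order-preserving one, carries the copy over \<open>A\<close>
  to the copy over \<open>B\<close>. In the wreath product, \<open>z\<close> becomes the element \<open>q\<close> by which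
  \<open>Psi u\<close> is conjugated.\<close>

lemma copy_conj: assumes z: "z \<in> carrier M" "src z = A" and u: "u \<in> copy K A"
  shows "iv z \<odot> u \<odot> z \<in> copy K (tgt z)"
proof -
  let ?B = "tgt z" and ?r = "card A"
  define v where "v = iv z \<odot> u \<odot> z"
  have uA: "u \<in> H_grp A" and uK: "Psi u \<in> K" using u by (auto simp: copy_def)
  have B: "?B \<subseteq> {1..n}" using carrierD(5)[OF z(1)] .
  have r: "?r \<le> n" using card_mono[OF _ A] by simp
  have cB: "card ?B = ?r" using rank_src[OF z(1)] z(2) by simp
  have v: "v \<in> H_grp ?B" using H_grp_conj[OF z(1)] uA z(2) by (simp add: v_def)
  note TA = theta[OF A] and TB = theta[OF B]
  let ?w = "theta A \<odot> z \<odot> iv (theta ?B)"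
  have w: "?w \<in> H_grp {1..?r}"
    using TA TB z cB by (simp add: H_grp_def mult_closed iv_closed src_mult_eq tgt_mult_eq)
  define q where "q = Psi ?w"
  have q: "q \<in> carrier (W ?r)" using Psi_closed[OF w] by (simp add: q_def)
  have Pq: "Phi ?r q = ?w" using Phi_Psi_interval[OF r w] by (simp add: q_def)
  have Pu: "Psi u \<in> carrier (W ?r)" and Pv: "Psi v \<in> carrier (W ?r)"
    using Psi_closed[OF uA] Psi_closed[OF v] cB by auto
  have PPv: "Phi ?r (Psi v) = theta ?B \<odot> (iv z \<odot> u \<odot> z) \<odot> iv (theta ?B)"
    using Phi_Psi[OF v, unfolded cB] unfolding v_def .
  \<comment> \<open>Both sides correspond to \<open>theta A \<odot> u \<odot> z \<odot> iv (theta ?B)\<close>.\<close>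
  have "q \<otimes>\<^bsub>W ?r\<^esub> Psi v = Psi u \<otimes>\<^bsub>W ?r\<^esub> q"
  proof (rule Phi_inj)
    show "Phi ?r (q \<otimes>\<^bsub>W ?r\<^esub> Psi v) = Phi ?r (Psi u \<otimes>\<^bsub>W ?r\<^esub> q)"
      using TA TB z H_grpD[OF uA]
      by (simp add: Phi_mult q Pu Pv Pq Phi_Psi[OF uA] PPv
        mult_assoc mult_closed iv_closed iv_cancel_left iv_cancel_left' src_mult_le)
  qed (intro W_closed q Pu Pv)+
  then have "Psi v = inv\<^bsub>W ?r\<^esub> q \<otimes>\<^bsub>W ?r\<^esub> Psi u \<otimes>\<^bsub>W ?r\<^esub> q"
    using q Pu Pv by (simp add: W_closed group.inv_solve_left[OF group_W[OF r]]
        monoid.m_assoc[OF group.is_monoid[OF group_W[OF r]]] group.inv_closed[OF group_W[OF r]])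
  then have "Psi v \<in> K" using normal.inv_op_closed1[OF K q uK] by simp
  with v show ?thesis by (simp add: copy_def v_def)
qed

end

lemma iv_iv: assumes z: "z \<in> carrier M" shows "iv (iv z) = z"
proof -
  have "iv (iv z) = iv (iv z) \<odot> (iv z \<odot> z)" using z by (simp add: iv_left E_right iv_closed)
  also have "\<dots> = z" using z by (simp add: iv_cancel_left iv_closed)
  finally show ?thesis .
qed

lemma diag_if_Psi: assumes u: "u \<in> H_grp A" and id: "snd (Psi u) = id" shows "snd u = snd (E A)"
proof
  fix i
  have th: "bij_betw (ord_bij A) {1..card A} A"
    using bij_ord_bij finite_subset[OF H_grp_subset[OF u]] by blast
  show "snd u i = snd (E A) i"
  proof (cases "i \<in> A")
    case False
    then show ?thesis using H_grpD(2)[OF u] by (auto simp: elem_defs)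
  next
    case True
    then obtain j where j: "j \<in> {1..card A}" "i = ord_bij A j" using th by (metis bij_betw_imp_surj_on imageE)
    obtain k where k: "snd u i = Some k" using True H_grpD(2)[OF u] by blast
    then have kA: "k \<in> A" using H_grpD(3)[OF u] by (auto simp: ran_def)
    have "gamma (snd u) j = j" using id by (simp add: Psi_def case_prod_beta)
    then have "inv_into {1..card A} (ord_bij A) k = j"
      using j k H_grpD(2)[OF u] by (simp add: gamma_def)
    then have "k = i" using kA th j by (metis bij_betw_inv_into_right)
    then show ?thesis using k True by (simp add: elem_defs)
  qed
qed

lemma Psi_diag: assumes "A \<subseteq> {1..n}" "snd u = snd (E A)" shows "snd (Psi u) = id"
proof -
  have "snd (Psi u) = snd (Psi (E A))" using assms(2) by (simp add: Psi_def case_prod_beta)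
  then show ?thesis by (simp add: Psi_E[OF assms(1)] W_one)
qed

text \<open>An element that fixes every point of its domain can be restricted on either side with the same
  effect. Such elements are called diagonal below; they are the members of the subgroups in
  ranks above \<open>m\<close>.\<close>

lemma diag_commute: assumes "u \<in> carrier M" "snd u = snd (E A)" shows "E B \<odot> u = u \<odot> E B"
proof (rule elem_eqI)
  fix i
  have s: "snd u i = (if i \<in> A then Some i else None)" by (simp add: assms elem_defs)
  show "snd (E B \<odot> u) i = snd (u \<odot> E B) i"
    using s by (simp add: snd_mult) (simp add: elem_defs)
  show "fst (E B \<odot> u) i = fst (u \<odot> E B) i"
    using s carrierD(1,2)[OF assms(1), of i]
    by (cases "fst u i") (auto simp: fst_mult elem_defs split: if_splits)
qed

section \<open>Congruences from chains of normal subgroups\<close>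

text \<open>The uniform shape of all the relations in the theorem: elements of rank below \<open>m\<close> are
  identified, and above that \<open>y\<close> is related to \<open>x\<close> when it differs from \<open>x\<close> by a right factor
  in the copy, over the image of \<open>x\<close>, of a normal subgroup that depends on the rank only. Using a right
  factor \<open>u\<close> instead of the quotient \<open>iv x \<odot> y\<close> makes the equality of domains and images of \<open>x\<close> and \<open>y\<close>
  automatic.\<close>

definition data_rel :: "nat \<Rightarrow> (nat \<Rightarrow> ((nat \<Rightarrow> 'a) \<times> (nat \<Rightarrow> nat)) set) \<Rightarrow> ('a pelem \<times> 'a pelem) set"
  where "data_rel m N = {(x, y). x \<in> carrier M \<and> y \<in> carrier M \<and> rank x < m \<and> rank y < m} \<union>
    {(x, y). x \<in> carrier M \<and> m \<le> rank x \<and> (\<exists>u \<in> copy (N (rank x)) (tgt x). y = x \<odot> u)}"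

text \<open>Deleting the last coordinate of a diagonal element is restriction to an initial segment.\<close>

lemma E_mult_Phi_diag:
  assumes "Phi r p \<in> carrier M" "snd p = id"
  shows "E {1..r - 1} \<odot> Phi r p = Phi (r - 1) (proj r (fst p), id)"
  by (rule elem_eqI) (simp_all add: E_mult_left[OF assms(1)], auto simp: Phi_def proj_def assms(2))

lemma card_le: "A \<subseteq> {1..n} \<Longrightarrow> card A \<le> n"
  using card_mono[of "{1..n}" A] by simp

end

text \<open>The conditions on the subgroups that make \<open>data_rel\<close> a congruence. The third one says that the
  family is stable under deleting the last coordinate; for \<open>r = m + 1\<close> it is the condition that
  links \<open>T\<^bsub>m+1\<^esub>\<close> with \<open>L\<close>, for larger \<open>r\<close> it is closedness of the family.\<close>

locale normal_chain = partial_aut_monoid +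
  fixes m :: nat and N :: "nat \<Rightarrow> ((nat \<Rightarrow> 'a) \<times> (nat \<Rightarrow> nat)) set"
  assumes N_normal: "\<And>r. m \<le> r \<Longrightarrow> r \<le> n \<Longrightarrow> N r \<lhd> W r"
    and N_diag: "\<And>r p. m < r \<Longrightarrow> r \<le> n \<Longrightarrow> p \<in> N r \<Longrightarrow> snd p = id"
    and N_proj: "\<And>r p. m < r \<Longrightarrow> r \<le> n \<Longrightarrow> p \<in> N r \<Longrightarrow> (proj r (fst p), id) \<in> N (r - 1)"

context normal_chain
begin

text \<open>Stability under deleting the last coordinate gives stability under deleting any point \<open>i\<close> of any
  subset \<open>A\<close>: an arrow \<open>z\<close> from \<open>{1..r}\<close> to \<open>A\<close> that sends \<open>r\<close> to \<open>i\<close> moves the question to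
  the initial segment, and its restriction \<open>z'\<close> moves the answer back.\<close>

lemma cut_last:
  assumes A: "A \<subseteq> {1..n}" and m: "m < card A" and u: "u \<in> copy (N (card A)) A" and i: "i \<in> A"
  shows "E (A - {i}) \<odot> u \<in> copy (N (card A - 1)) (A - {i})"
proof -
  define r B where "r = card A" and "B = A - {i}"
  have fA: "finite A" using A finite_subset by blast
  have r: "r \<le> n" "m < r" "1 \<le> r" using card_le[OF A] m by (auto simp: r_def)
  have cB: "card B = r - 1" using i fA by (simp add: B_def r_def)
  have BA: "B \<subseteq> A" "B \<subseteq> {1..n}" "finite B" using A fA by (auto simp: B_def)
  have th: "bij_betw (ord_bij B) {1..r - 1} B" using bij_ord_bij[OF BA(3)] cB by simp
  define z where "z = map_elem G {1..r} (\<lambda>j. if j = r then i else ord_bij B j)"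
  have I: "{1..r} = insert r {1..r - 1}" using r by auto
  have img: "(\<lambda>j. if j = r then i else ord_bij B j) ` {1..r - 1} = B"
  proof -
    have "(\<lambda>j. if j = r then i else ord_bij B j) ` {1..r - 1} = ord_bij B ` {1..r - 1}"
      using r by (intro image_cong) auto
    then show ?thesis using th by (simp add: bij_betw_def)
  qed
  have tz: "(\<lambda>j. if j = r then i else ord_bij B j) ` {1..r} = A"
    unfolding I image_insert img using i by (auto simp: B_def)
  have inj: "inj_on (\<lambda>j. if j = r then i else ord_bij B j) {1..r}"
    by (rule eq_card_imp_inj_on) (simp, simp only: tz r_def[symmetric], simp)
  have z: "z \<in> carrier M" "src z = {1..r}" "tgt z = A"
    using A r map_elem_closed[OF _ inj] tz by (auto simp: z_def)
  have uh: "u \<in> H_grp A" using u by (rule copy_H_grp)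
  define w where "w = z \<odot> u \<odot> iv z"
  have w: "w \<in> copy (N r) {1..r}"
    using copy_conj[of "N (card A)" A "iv z" u] N_normal[of r] r A u z
    by (simp add: iv_closed iv_iv w_def r_def[symmetric])
  have wh: "w \<in> H_grp {1..r}" using w by (rule copy_H_grp)
  define p where "p = Psi w"
  have p: "p \<in> N r" using w by (simp add: copy_def p_def)
  have wp: "w = Phi r p" using Phi_Psi_interval[OF r(1) wh] by (simp add: p_def)
  have pid: "snd p = id" using N_diag r p by blast
  let ?E = "E {1..r - 1}"
  have E: "?E \<in> carrier M" using r by (intro E_closed) auto
  define q where "q = (proj r (fst p), id :: nat \<Rightarrow> nat)"
  have q: "q \<in> N (r - 1)" using N_proj[OF r(2,1) p] by (simp add: q_def)
  have qW: "q \<in> carrier (W (r - 1))"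
    using q N_normal[of "r - 1"] r subgroup.subset[OF normal_imp_subgroup] by fastforce
  have Ew: "?E \<odot> w = Phi (r - 1) q"
    using E_mult_Phi_diag[of r p] H_grpD(1)[OF wh] pid by (simp add: wp q_def)
  have Ew': "?E \<odot> w \<in> copy (N (r - 1)) {1..r - 1}"
    using Psi_Phi[OF _ qW] Phi_H_grp[OF _ qW] q r by (simp add: copy_def Ew)
  define z' where "z' = ?E \<odot> z"
  have z'e: "z' = map_elem G {1..r - 1} (ord_bij B)"
    unfolding z'_def by (rule elem_eqI) (use r in \<open>auto simp: E_mult_left z(1)\<close>, auto simp: z_def elem_defs)
  have z': "z' \<in> carrier M" "src z' = {1..r - 1}" "tgt z' = B"
    using mult_closed[OF E z(1)] th by (simp add: z'_def, simp add: z'e, simp add: z'e bij_betw_def)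
  \<comment> \<open>Since \<open>w\<close> is diagonal, the restriction can be moved across it to meet \<open>z\<close>.\<close>
  have c: "w \<odot> ?E = ?E \<odot> w"
    using diag_commute[OF H_grpD(1)[OF wh] diag_if_Psi[OF wh]] pid by (simp add: p_def)
  have "(?E \<odot> w) \<odot> z' = ?E \<odot> (w \<odot> ?E) \<odot> z"
    using E H_grpD(1)[OF wh] z by (simp add: z'_def mult_assoc mult_closed)
  also have "\<dots> = (?E \<odot> ?E) \<odot> (w \<odot> z)"
    unfolding c using E H_grpD(1)[OF wh] z by (simp add: mult_assoc mult_closed)
  also have "\<dots> = ?E \<odot> (z \<odot> (u \<odot> (iv z \<odot> z)))"
    using E H_grpD[OF uh] z by (simp add: E_mult_E w_def mult_assoc mult_closed iv_closed)
  also have "\<dots> = z' \<odot> u"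
    using E H_grpD[OF uh] z by (simp add: z'_def iv_left E_right mult_assoc)
  finally have *: "(?E \<odot> w) \<odot> z' = z' \<odot> u" .
  have "iv z' \<odot> (?E \<odot> w) \<odot> z' \<in> copy (N (r - 1)) B"
  proof -
    have "N (r - 1) \<lhd> W (card {1..r - 1})" using N_normal[of "r - 1"] r by simp
    moreover have "{1..r - 1} \<subseteq> {1..n}" using r by auto
    ultimately show ?thesis using copy_conj[OF _ _ z'(1,2) Ew'] z'(3) by metis
  qed
  moreover have "iv z' \<odot> (?E \<odot> w) \<odot> z' = E B \<odot> u"
    using * z' mult_closed[OF E H_grpD(1)[OF wh]] H_grpD(1)[OF uh]
    by (simp add: mult_assoc[of _ "?E \<odot> w"] iv_closed) (simp add: mult_assoc[symmetric] iv_closed iv_left)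
  ultimately show ?thesis by (simp add: r_def B_def)
qed

lemma cut:
  assumes A: "A \<subseteq> {1..n}" and u: "u \<in> copy (N (card A)) A" and B: "B \<subseteq> A" "m \<le> card B"
  shows "E B \<odot> u \<in> copy (N (card B)) B"
  using A u B(1)
proof (induction "card (A - B)" arbitrary: A u)
  case 0
  then have "finite A" using finite_subset by blast
  then have "A = B" using 0 by auto
  then show ?case using 0(3) H_grpD[OF copy_H_grp[OF 0(3)]] by (simp add: E_left)
next
  case (Suc k)
  have fA: "finite A" using Suc.prems finite_subset by blast
  obtain i where i: "i \<in> A" "i \<notin> B" using Suc.hyps(2) by (metis DiffE card_eq_0_iff ex_in_conv nat.distinct(1))
  have AB: "card B < card A" using i Suc.prems fA by (intro psubset_card_mono) auto
  have c: "card (A - {i}) = card A - 1" using i fA by simp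
  have "A - {i} - B = (A - B) - {i}" by auto
  then have k: "k = card (A - {i} - B)" using Suc.hyps(2) i fA by simp
  have "E B \<odot> (E (A - {i}) \<odot> u) \<in> copy (N (card B)) B"
    using Suc.hyps(1)[OF k, of "E (A - {i}) \<odot> u"] cut_last[OF Suc.prems(1) _ Suc.prems(2) i(1)]
      AB B(2) Suc.prems i c by auto
  moreover have "E B \<odot> (E (A - {i}) \<odot> u) = E B \<odot> u"
    using Suc.prems i H_grpD(1)[OF copy_H_grp[OF Suc.prems(2)]]
    by (subst mult_assoc[symmetric]) (auto intro!: E_closed simp: E_mult_E Int_absorb2 subset_Diff_insert dest: subsetD)
  ultimately show ?case by simp
qed

lemma cut_commute:
  assumes A: "A \<subseteq> {1..n}" and u: "u \<in> copy (N (card A)) A" and B: "B \<subseteq> A" "m \<le> card B"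
  shows "E B \<odot> u = u \<odot> E B"
proof (cases "A = B")
  case True
  then show ?thesis using H_grpD[OF copy_H_grp[OF u]] by (simp add: E_left E_right)
next
  case False
  then have "card B < card A" using A B finite_subset by (intro psubset_card_mono) auto
  then have "snd (Psi u) = id" using N_diag[of "card A"] u card_le[OF A] B by (auto simp: copy_def)
  then show ?thesis using diag_commute diag_if_Psi H_grpD(1) copy_H_grp[OF u] by blast
qed

lemma data_relE:
  assumes "(x, y) \<in> data_rel m N"
  obtains "x \<in> carrier M" "y \<in> carrier M" "rank x < m" "rank y < m"
  | u where "x \<in> carrier M" "m \<le> rank x" "u \<in> copy (N (rank x)) (tgt x)" "y = x \<odot> u"
  using assms by (auto simp: data_rel_def)

lemma data_rel_equiv: "equiv (carrier M) (data_rel m N)"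
proof (rule equivI)
  show "data_rel m N \<subseteq> carrier M \<times> carrier M"
  proof (rule subrelI)
    fix x y assume "(x, y) \<in> data_rel m N"
    then show "(x, y) \<in> carrier M \<times> carrier M"
    proof (cases rule: data_relE)
      case 1 then show ?thesis by simp
    next
      case (2 u) then show ?thesis using mult_closed H_grpD(1)[OF copy_H_grp[OF 2(3)]] by simp
    qed
  qed
  show "refl_on (carrier M) (data_rel m N)"
  proof (rule refl_onI)
    fix x assume x: "x \<in> carrier M"
    show "(x, x) \<in> data_rel m N"
    proof (cases "rank x < m")
      case True then show ?thesis using x by (simp add: data_rel_def)
    next
      case False
      have "E (tgt x) \<in> copy (N (rank x)) (tgt x)"
        using False carrierD(5)[OF x] card_le by (intro copy_E N_normal) auto
      moreover have "x = x \<odot> E (tgt x)" using x by (simp add: E_right)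
      ultimately show ?thesis using False x by (force simp: data_rel_def)
    qed
  qed
  show "sym (data_rel m N)"
  proof (rule symI)
    fix x y assume "(x, y) \<in> data_rel m N"
    then show "(y, x) \<in> data_rel m N"
    proof (cases rule: data_relE)
      case 1 then show ?thesis by (simp add: data_rel_def)
    next
      case (2 u)
      note U = H_grpD[OF copy_H_grp[OF 2(3)]]
      have t: "tgt y = tgt x" using U 2 by (simp add: tgt_mult_eq)
      have "iv u \<in> copy (N (rank x)) (tgt x)"
        using 2 carrierD(5) card_le by (intro copy_iv N_normal) auto
      moreover have "x = y \<odot> iv u" using 2 U by (simp add: mult_assoc iv_closed iv_right E_right)
      moreover have "y \<in> carrier M" using 2 U mult_closed by simp
      ultimately show ?thesis using 2(2) t unfolding data_rel_def by auto
    qed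
  qed
  show "trans (data_rel m N)"
  proof (rule transI)
    fix x y z assume xy: "(x, y) \<in> data_rel m N" and yz: "(y, z) \<in> data_rel m N"
    from xy show "(x, z) \<in> data_rel m N"
    proof (cases rule: data_relE)
      case 1 with yz show ?thesis by (auto simp: data_rel_def)
    next
      case (2 u)
      note U = H_grpD[OF copy_H_grp[OF 2(3)]]
      have t: "tgt y = tgt x" using U 2 by (simp add: tgt_mult_eq)
      from yz obtain v where v: "v \<in> copy (N (rank x)) (tgt x)" "z = y \<odot> v"
        using t 2(2) by (auto elim: data_relE)
      have "u \<odot> v \<in> copy (N (rank x)) (tgt x)"
        using 2 v carrierD(5) card_le by (intro copy_mult N_normal) auto
      moreover have "z = x \<odot> (u \<odot> v)" using 2 v U H_grpD[OF copy_H_grp[OF v(1)]] by (simp add: mult_assoc)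
      ultimately show ?thesis using 2 by (auto simp: data_rel_def)
    qed
  qed
qed

text \<open>Left multiplication does not change the factor \<open>u\<close>, except that it has to be restricted to the
  image of the product.\<close>

lemma data_rel_left: assumes "(x, y) \<in> data_rel m N" and z: "z \<in> carrier M" shows "(z \<odot> x, z \<odot> y) \<in> data_rel m N"
  using assms(1)
proof (cases rule: data_relE)
  case 1
  have "rank (z \<odot> x) \<le> rank x" if "x \<in> carrier M" for x
    using carrierD(6)[OF that] by (simp add: rank_mult z that rank_src card_mono)
  then have "rank (z \<odot> x) < m" "rank (z \<odot> y) < m" using 1 le_less_trans by blast+
  then show ?thesis using 1 z mult_closed by (simp add: data_rel_def)
next
  case (2 u)
  let ?B = "tgt (z \<odot> x)"
  note U = H_grpD[OF copy_H_grp[OF 2(3)]]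
  have zx: "z \<odot> x \<in> carrier M" using 2 z by (simp add: mult_closed)
  have BA: "?B \<subseteq> tgt x" by (rule tgt_mult_le) simp
  have e: "z \<odot> y = (z \<odot> x) \<odot> u" using 2 z U by (simp add: mult_assoc)
  show ?thesis
  proof (cases "rank (z \<odot> x) < m")
    case True
    moreover have "rank (z \<odot> y) = rank (z \<odot> x)"
      unfolding e using BA U by (subst rank_mult) (auto simp: zx Int_absorb2)
    ultimately show ?thesis using zx mult_closed[OF zx U(1)] e by (simp add: data_rel_def)
  next
    case False
    have c: "E ?B \<odot> u \<in> copy (N (card ?B)) ?B"
      using cut[OF carrierD(5)[OF 2(1)] 2(3) BA] False by simp
    have "z \<odot> y = (z \<odot> x) \<odot> (E ?B \<odot> u)"
      using e zx U carrierD(5)[OF zx] by (simp add: mult_assoc[symmetric] E_closed E_right)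
    then show ?thesis using c False zx unfolding data_rel_def by auto
  qed
qed

text \<open>If the product keeps rank at least \<open>m\<close>, only the part \<open>?z\<close> of \<open>z\<close> over \<open>?B\<close> matters. Restricting
  the factor \<open>u\<close> to \<open>?B\<close> and conjugating by \<open>?z\<close> yields the new factor; for this, the restriction
  must be possible on either side of \<open>u\<close>, which holds because \<open>u\<close> is diagonal unless \<open>?B\<close> is all of
  the image of \<open>x\<close>.\<close>

lemma data_rel_right: assumes "(x, y) \<in> data_rel m N" and z: "z \<in> carrier M" shows "(x \<odot> z, y \<odot> z) \<in> data_rel m N"
  using assms(1)
proof (cases rule: data_relE)
  case 1
  have "rank (x \<odot> z) \<le> rank x" if "x \<in> carrier M" for x
    using carrierD(7)[OF that] by (simp add: rank_mult z that card_mono)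
  then have "rank (x \<odot> z) < m" "rank (y \<odot> z) < m" using 1 le_less_trans by blast+
  then show ?thesis using 1 z mult_closed by (simp add: data_rel_def)
next
  case (2 u)
  let ?A = "tgt x" and ?B = "tgt x \<inter> src z"
  note U = H_grpD[OF copy_H_grp[OF 2(3)]]
  note A = carrierD(5)[OF 2(1)]
  have t: "tgt y = tgt x" using U 2 by (simp add: tgt_mult_eq)
  have y: "y \<in> carrier M" using 2 U mult_closed by simp
  have xz: "x \<odot> z \<in> carrier M" "y \<odot> z \<in> carrier M" using 2 y z by (simp_all add: mult_closed)
  have rk: "rank (x \<odot> z) = card ?B" "rank (y \<odot> z) = card ?B" using 2 y z t by (simp_all add: rank_mult)
  show ?thesis
  proof (cases "card ?B < m")
    case True
    then show ?thesis using rk xz by (simp add: data_rel_def)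
  next
    case False
    have B: "?B \<subseteq> ?A" "?B \<subseteq> {1..n}" "m \<le> card ?B" using False A by auto
    have EB: "E ?B \<in> carrier M" by (rule E_closed[OF B(2)])
    note c = cut[OF A 2(3) B(1,3)] and cc = cut_commute[OF A 2(3) B(1,3)]
    let ?v = "E ?B \<odot> u" and ?z = "E ?B \<odot> z"
    have z': "?z \<in> carrier M" "src ?z = ?B" using mult_closed[OF EB z] by (auto simp: src_E_mult)
    \<comment> \<open>After an element with image \<open>?A\<close>, the factor \<open>z\<close> can be replaced by its restriction \<open>?z\<close>.\<close>
    have EA: "E ?A \<odot> z = ?z"
      using E_left[OF z] z A carrierD(4)[OF z]
      by (metis E_closed E_mult_E mult_assoc order_refl)
    have left: "a \<odot> z = a \<odot> ?z" if "a \<in> carrier M" "tgt a = ?A" for a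
      using E_right[OF that(1)] that z A EA by (metis E_closed mult_assoc order_refl)
    have tz: "tgt (x \<odot> z) = tgt ?z" using left[OF 2(1)] z' B(1) by (simp add: tgt_mult_eq)
    have v: "?v \<in> carrier M" using mult_closed[OF EB U(1)] .
    have sv: "src ?v \<subseteq> ?B" unfolding src_E_mult by blast
    have "iv ?z \<odot> ?v \<odot> ?z \<in> copy (N (card ?B)) (tgt ?z)"
      using copy_conj[OF N_normal[OF B(3) card_le[OF B(2)]] B(2) z' c] .
    moreover have "y \<odot> z = (x \<odot> z) \<odot> (iv ?z \<odot> ?v \<odot> ?z)"
    proof -
      have "(x \<odot> z) \<odot> (iv ?z \<odot> ?v \<odot> ?z) = x \<odot> (?z \<odot> (iv ?z \<odot> (?v \<odot> ?z)))"
        unfolding left[OF 2(1) refl] using 2(1) z'(1) v by (simp only: mult_assoc mult_closed iv_closed)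
      also have "?z \<odot> (iv ?z \<odot> (?v \<odot> ?z)) = ?v \<odot> ?z"
        by (rule iv_cancel_left'[OF z'(1) mult_closed[OF v z'(1)]]) (simp only: z'(2) src_mult_le[OF sv])
      also have "?v \<odot> ?z = u \<odot> (E ?B \<odot> ?z)"
        unfolding cc using z'(1) U EB by (simp only: mult_assoc)
      also have "E ?B \<odot> ?z = ?z" using z' by (simp add: E_left)
      also have "u \<odot> ?z = u \<odot> z" using left[OF U(1,3)] by simp
      also have "x \<odot> (u \<odot> z) = y \<odot> z" using 2 U z by (simp add: mult_assoc)
      finally show ?thesis by simp
    qed
    ultimately show ?thesis using xz(1) B(3) rk tz unfolding data_rel_def by auto
  qed
qed

theorem data_rel_congruence: "congruence M (data_rel m N)"
  unfolding congruence_def using data_rel_equiv data_rel_left data_rel_right by auto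

end

context partial_aut_monoid
begin

section \<open>The relation of the theorem as such a congruence\<close>

abbreviation P where "P r \<equiv> power_group G r"

lemma group_P: "group (P r)"
  by (simp add: power_group_def product_group)

lemma W_diag_mult: "(s, id) \<otimes>\<^bsub>W r\<^esub> (t, id) = (s \<otimes>\<^bsub>P r\<^esub> t, id)"
  by (simp add: W_mult power_group_def)

lemma W_diag_closed: "(t, id) \<in> carrier (W r) \<longleftrightarrow> t \<in> carrier (P r)"
  by (simp add: W_iff power_group_def permutes_id)

lemma W_diag_one: "\<one>\<^bsub>W r\<^esub> = (\<one>\<^bsub>P r\<^esub>, id)"
  by (simp add: W_one power_group_def)

lemma W_diag_inv: assumes "r \<le> n" "t \<in> carrier (P r)" shows "inv\<^bsub>W r\<^esub> (t, id) = (inv\<^bsub>P r\<^esub> t, id)"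
  using assms by (intro group.inv_equality[OF group_W])
    (simp_all add: W_diag_mult W_diag_closed W_diag_one group.l_inv[OF group_P] group.inv_closed[OF group_P])

lemma permuted_closed:
  "\<sigma> permutes {1..r} \<Longrightarrow> t \<in> carrier (P r) \<Longrightarrow> (\<lambda>j\<in>{1..r}. t (\<sigma> j)) \<in> carrier (P r)"
  using permutes_in_image[of \<sigma> "{1..r}"] by (simp add: power_group_def PiE_iff)

text \<open>Conjugation by \<open>(s, \<sigma>)\<close> first permutes the entries of \<open>t\<close> and then conjugates by \<open>s\<close>. Hence
  a normal subgroup of \<open>G\<^sup>r\<close> is normal in the wreath product as soon as it is permutation invariant;
  the lemma after this one is the converse.\<close>

lemma diag_normal:
  assumes r: "r \<le> n" and T: "T \<lhd> P r" and inv: "perm_invariant G r T"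
  shows "{(t, id :: nat \<Rightarrow> nat) |t. t \<in> T} \<lhd> W r"
proof (rule group.normal_invI[OF group_W[OF r]])
  note sT = normal_imp_subgroup[OF T]
  have TP: "t \<in> carrier (P r)" if "t \<in> T" for t using subgroup.mem_carrier[OF sT that] .
  interpret W: group "W r" by (rule group_W[OF r])
  interpret P: group "P r" by (rule group_P)
  show "subgroup {(t, id :: nat \<Rightarrow> nat) |t. t \<in> T} (W r)"
  proof (rule W.subgroupI)
    show "{(t, id :: nat \<Rightarrow> nat) |t. t \<in> T} \<subseteq> carrier (W r)" using TP W_diag_closed by blast
    show "{(t, id :: nat \<Rightarrow> nat) |t. t \<in> T} \<noteq> {}" using subgroup.one_closed[OF sT] by blast
    show "inv\<^bsub>W r\<^esub> a \<in> {(t, id :: nat \<Rightarrow> nat) |t. t \<in> T}" if "a \<in> {(t, id :: nat \<Rightarrow> nat) |t. t \<in> T}" for a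
      using that W_diag_inv[OF r] TP subgroup.m_inv_closed[OF sT] by auto
    show "a \<otimes>\<^bsub>W r\<^esub> b \<in> {(t, id :: nat \<Rightarrow> nat) |t. t \<in> T}"
      if "a \<in> {(t, id :: nat \<Rightarrow> nat) |t. t \<in> T}" "b \<in> {(t, id :: nat \<Rightarrow> nat) |t. t \<in> T}" for a b
      using that W_diag_mult subgroup.m_closed[OF sT] by auto
  qed
  fix x h assume x: "x \<in> carrier (W r)" and "h \<in> {(t, id :: nat \<Rightarrow> nat) |t. t \<in> T}"
  then obtain t where t: "t \<in> T" "h = (t, id)" by blast
  obtain s \<sigma> where xs: "x = (s, \<sigma>)" by fastforce
  have s: "s \<in> carrier (P r)" "\<sigma> permutes {1..r}" using x by (simp_all add: xs W_iff power_group_def)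
  define t' where "t' = (\<lambda>j\<in>{1..r}. t (\<sigma> j))"
  have t': "t' \<in> T" using inv s TP[OF t(1)] t(1) unfolding perm_invariant_def t'_def by blast
  define c where "c = s \<otimes>\<^bsub>P r\<^esub> t' \<otimes>\<^bsub>P r\<^esub> inv\<^bsub>P r\<^esub> s"
  have c: "c \<in> T" using normal.inv_op_closed2[OF T s(1) t'] by (simp add: c_def)
  \<comment> \<open>It suffices to move \<open>x\<close> past \<open>h\<close>: \<open>x h = (c, id) x\<close>.\<close>
  have "x \<otimes>\<^bsub>W r\<^esub> h = (s \<otimes>\<^bsub>P r\<^esub> t', \<sigma>)"
    by (auto simp: xs t W_mult power_group_def t'_def fun_eq_iff)
  also have "s \<otimes>\<^bsub>P r\<^esub> t' = c \<otimes>\<^bsub>P r\<^esub> s"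
    using s TP[OF t'] by (simp add: c_def P.m_assoc)
  also have "(c \<otimes>\<^bsub>P r\<^esub> s, \<sigma>) = (c, id) \<otimes>\<^bsub>W r\<^esub> x"
    by (auto simp: xs W_mult power_group_def fun_eq_iff)
  finally have "x \<otimes>\<^bsub>W r\<^esub> h \<otimes>\<^bsub>W r\<^esub> inv\<^bsub>W r\<^esub> x = (c, id)"
    using x TP[OF c] W_diag_closed by (simp add: W.m_assoc)
  then show "x \<otimes>\<^bsub>W r\<^esub> h \<otimes>\<^bsub>W r\<^esub> inv\<^bsub>W r\<^esub> x \<in> {(t, id :: nat \<Rightarrow> nat) |t. t \<in> T}" using c by blast
qed

lemma normal_diag:
  assumes r: "r \<le> n" and K: "K \<lhd> W r"
  shows "{t. (t, id) \<in> K} \<lhd> P r" and "perm_invariant G r {t. (t, id) \<in> K}"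
proof -
  note sK = normal_imp_subgroup[OF K]
  interpret W: group "W r" by (rule group_W[OF r])
  interpret P: group "P r" by (rule group_P)
  let ?T = "{t. (t, id) \<in> K}"
  have TP: "t \<in> carrier (P r)" if "(t, id) \<in> K" for t
    using subgroup.mem_carrier[OF sK that] W_diag_closed by blast
  show "?T \<lhd> P r"
  proof (rule P.normal_invI)
    show "subgroup ?T (P r)"
    proof (rule P.subgroupI)
      show "?T \<subseteq> carrier (P r)" using TP by blast
      show "?T \<noteq> {}" using subgroup.one_closed[OF sK] W_diag_one by auto
      show "inv\<^bsub>P r\<^esub> a \<in> ?T" if "a \<in> ?T" for a
        using that subgroup.m_inv_closed[OF sK, of "(a, id)"] W_diag_inv[OF r TP] by simp
      show "a \<otimes>\<^bsub>P r\<^esub> b \<in> ?T" if "a \<in> ?T" "b \<in> ?T" for a b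
        using that subgroup.m_closed[OF sK, of "(a, id)" "(b, id)"] W_diag_mult by simp
    qed
    show "x \<otimes>\<^bsub>P r\<^esub> h \<otimes>\<^bsub>P r\<^esub> inv\<^bsub>P r\<^esub> x \<in> ?T" if "x \<in> carrier (P r)" "h \<in> ?T" for x h
      using normal.inv_op_closed2[OF K, of "(x, id)" "(h, id)"] that
      by (simp add: W_diag_closed W_diag_inv[OF r] W_diag_mult)
  qed
  have *: "(\<lambda>j\<in>{1..r}. t (\<sigma> j)) \<in> ?T" if s: "\<sigma> permutes {1..r}" and t: "t \<in> ?T" for \<sigma> t
  proof -
    let ?t = "\<lambda>j\<in>{1..r}. t (\<sigma> j)" and ?x = "(\<one>\<^bsub>P r\<^esub>, \<sigma>)"
    have tP: "t \<in> carrier (P r)" using TP t by blast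
    have x: "?x \<in> carrier (W r)" using s P.one_closed by (simp add: W_iff power_group_def)
    have t': "(?t, id) \<in> carrier (W r)" using permuted_closed[OF s tP] W_diag_closed by blast
    have tG: "t (\<sigma> i) \<in> carrier G" if "i \<in> {1..r}" for i
      using tP that permutes_in_image[OF s] by (auto simp: power_group_def PiE_iff)
    have "?x \<otimes>\<^bsub>W r\<^esub> (t, id) = (?t, id) \<otimes>\<^bsub>W r\<^esub> ?x"
      using tG by (auto simp: W_mult power_group_def fun_eq_iff)
    then have "?x \<otimes>\<^bsub>W r\<^esub> (t, id) \<otimes>\<^bsub>W r\<^esub> inv\<^bsub>W r\<^esub> ?x = (?t, id)"
      using x t' by (simp add: W.m_assoc)
    then show ?thesis using normal.inv_op_closed2[OF K x, of "(t, id)"] t by simp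
  qed
  show "perm_invariant G r ?T"
    unfolding perm_invariant_def
  proof (intro allI impI ballI iffI)
    fix \<sigma> t assume s: "\<sigma> permutes {1..r}" and t: "t \<in> carrier (P r)"
    show "(\<lambda>j\<in>{1..r}. t (\<sigma> j)) \<in> ?T" if "t \<in> ?T" using *[OF s that] .
    assume "(\<lambda>j\<in>{1..r}. t (\<sigma> j)) \<in> ?T"
    from *[OF permutes_inv[OF s] this]
    have "(\<lambda>j\<in>{1..r}. (\<lambda>j\<in>{1..r}. t (\<sigma> j)) (Hilbert_Choice.inv \<sigma> j)) \<in> ?T" .
    moreover have "(\<lambda>j\<in>{1..r}. (\<lambda>j\<in>{1..r}. t (\<sigma> j)) (Hilbert_Choice.inv \<sigma> j)) = t"
    proof (rule extensionalityI[of _ "{1..r}"])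
      show "t \<in> extensional {1..r}" using t by (simp add: power_group_def PiE_iff)
      fix j assume "j \<in> {1..r}"
      then show "(\<lambda>j\<in>{1..r}. (\<lambda>j\<in>{1..r}. t (\<sigma> j)) (Hilbert_Choice.inv \<sigma> j)) j = t j"
        using permutes_in_image[OF permutes_inv[OF s], of j] permutes_inverses(1)[OF s] by simp
    qed simp
    ultimately show "t \<in> ?T" by simp
  qed
qed

text \<open>The subgroup \<open>L\<close> in rank \<open>m\<close> and the groups \<open>T\<^sub>r\<close>, viewed inside the wreath products, in the
  ranks above.\<close>

definition normal_seq :: "nat \<Rightarrow> (nat \<Rightarrow> (nat \<Rightarrow> 'a) set) \<Rightarrow> ((nat \<Rightarrow> 'a) \<times> (nat \<Rightarrow> nat)) set
    \<Rightarrow> nat \<Rightarrow> ((nat \<Rightarrow> 'a) \<times> (nat \<Rightarrow> nat)) set"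
  where "normal_seq m T L r = (if r = m then L else {(t, id) |t. t \<in> T r})"

lemma normal_chain_normal_seq:
  assumes D: "congruence_data G n m T L"
  shows "normal_chain G n m (normal_seq m T L)"
proof -
  have 1: "normal_seq m T L r \<lhd> W r" if "m \<le> r" "r \<le> n" for r
    using D that diag_normal[OF that(2)] by (auto simp: congruence_data_def normal_seq_def)
  have 2: "snd p = id" if "m < r" "p \<in> normal_seq m T L r" for r p
    using that by (auto simp: normal_seq_def)
  have 3: "(proj r (fst p), id) \<in> normal_seq m T L (r - 1)"
    if r: "m < r" "r \<le> n" and p: "p \<in> normal_seq m T L r" for r p
  proof -
    obtain t where t: "p = (t, id)" "t \<in> T r" using r p by (auto simp: normal_seq_def)
    show ?thesis
    proof (cases "r = m + 1")
      case True
      then show ?thesis using D r t by (auto simp: congruence_data_def normal_seq_def)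
    next
      case False
      then have "r \<in> {m + 2..n}" using r by auto
      then have "proj r t \<in> T (r - 1)" using D t(2) unfolding congruence_data_def closed_family_def by blast
      moreover have "r - 1 \<noteq> m" using False r by arith
      ultimately show ?thesis using t by (simp add: normal_seq_def)
    qed
  qed
  show ?thesis
    by (intro normal_chain.intro normal_chain_axioms.intro partial_aut_monoid_axioms 1 2 3)
qed

lemma L_copy_eq: "L_copy G n L e = copy L (dom e)"
proof (rule Set.set_eqI)
  fix x show "x \<in> L_copy G n L e \<longleftrightarrow> x \<in> copy L (dom e)"
    by (cases x) (simp add: L_copy_def H_class_def copy_def H_grp_def; blast)
qed

text \<open>The relation \<open>chi\<close> compares group entries over the domain, \<open>data_rel\<close> compares elements over the
  image. Writing \<open>x = x' \<odot> al\<close> and \<open>y = y' \<odot> al\<close> with diagonal \<open>x'\<close> and \<open>y'\<close>, the tuple in \<open>chi\<close> is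
  \<open>k = iv y' \<odot> x'\<close>, and conjugation by the common arrow \<open>al\<close> takes it to the inverse of the
  factor \<open>u\<close>.\<close>

lemma same_shape_factor:
  assumes x: "x \<in> carrier M" and y: "y \<in> carrier M" and xy: "snd x = snd y"
    and K: "K \<lhd> W (rank x)"
  shows "(\<exists>u \<in> copy K (tgt x). y = x \<odot> u) \<longleftrightarrow> (Omega (tmult G (tinv G (fst y)) (fst x)), id) \<in> K"
proof -
  let ?A = "src x" and ?B = "tgt x"
  have A: "?A \<subseteq> {1..n}" "?B \<subseteq> {1..n}" using carrierD[OF x] by auto
  have sy: "src y = ?A" "tgt y = ?B" using xy by simp_all
  have cA: "card ?A = rank x" using rank_src[OF x] by simp
  define al where "al = map_elem G ?A (\<lambda>i. the (snd x i))"
  define x' where "x' = (fst x, snd (E ?A))"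
  define y' where "y' = (fst y, snd (E ?A))"
  have al: "al \<in> carrier M" "src al = ?A" "tgt al = ?B"
    using bij_src_tgt[OF x] A map_elem_closed[OF A(1), of "\<lambda>i. the (snd x i)"]
    by (simp_all add: bij_betw_def al_def)
  have hx: "(fst z, snd (E ?A)) \<in> H_grp ?A" if "z \<in> carrier M" "src z = ?A" for z
  proof -
    have "(fst z, snd (E ?A)) \<in> carrier M"
    proof (rule carrierI)
      show "fst (fst z, snd (E ?A)) i = None \<longleftrightarrow> snd (fst z, snd (E ?A)) i = None" for i
        using carrierD(1)[OF that(1), of i] that(2) by (auto simp: E_def)
      show "c \<in> carrier G" if "fst (fst z, snd (E ?A)) i = Some c" for i c
        using that carrierD(2)[OF \<open>z \<in> carrier M\<close>] by simp
    qed (use A in \<open>auto simp: E_def ran_def split: if_splits\<close>)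
    then show ?thesis by (simp add: H_grp_def)
  qed
  have x': "x' \<in> H_grp ?A" and y': "y' \<in> H_grp ?A" using hx x y sy by (simp_all add: x'_def y'_def)
  note X' = H_grpD[OF x'] and Y' = H_grpD[OF y']
  have fac: "(fst z, snd (E ?A)) \<odot> al = z" if z: "z \<in> carrier M" "snd z = snd x" for z
  proof (rule elem_eqI)
    fix i
    show "snd ((fst z, snd (E ?A)) \<odot> al) i = snd z i"
      using z(2) by (auto simp: snd_mult elem_defs al_def domIff split: option.split)
    show "fst ((fst z, snd (E ?A)) \<odot> al) i = fst z i"
      using z(2) carrierD(1,2)[OF z(1), of i]
      by (cases "fst z i") (auto simp: fst_mult elem_defs al_def domIff split: option.split)
  qed
  have fx: "x' \<odot> al = x" and fy: "y' \<odot> al = y" using fac x y xy by (simp_all add: x'_def y'_def)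
  define k where "k = iv y' \<odot> x'"
  have k: "k \<in> H_grp ?A" unfolding k_def by (intro H_grp_mult H_grp_iv x' y')
  have sk: "snd k = snd (E ?A)"
  proof
    fix i
    have "snd (iv y') i = (if i \<in> ?A then Some i else None)"
    proof (cases "i \<in> ?A")
      case True then show ?thesis using snd_iv[OF Y'(1), of i i] by (simp add: y'_def E_def)
    next
      case False then show ?thesis using H_grpD(2)[OF H_grp_iv[OF y']] by (auto simp: domIff)
    qed
    then show "snd k i = snd (E ?A) i" by (simp add: k_def snd_mult x'_def E_def)
  qed
  have fk: "fst k = tmult G (tinv G (fst y)) (fst x)"
  proof
    fix i
    show "fst k i = tmult G (tinv G (fst y)) (fst x) i"
    proof (cases "i \<in> ?A")
      case True
      then have "snd (iv y') i = Some i" using snd_iv[OF Y'(1), of i i] by (simp add: y'_def E_def)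
      then show ?thesis by (simp add: k_def fst_mult fst_iv tmult_def tinv_def) (simp add: x'_def y'_def)
    next
      case False
      then have "fst k i = None" "fst x i = None"
        using carrierD(1)[OF H_grpD(1)[OF k]] carrierD(1)[OF x] H_grpD(2)[OF k] by (auto simp: domIff)
      then show ?thesis by (simp add: tmult_def)
    qed
  qed
  have "k \<in> copy K ?A \<longleftrightarrow> (Omega (tmult G (tinv G (fst y)) (fst x)), id) \<in> K"
    using k Psi_diag[OF A(1) sk] fk by (simp add: copy_def Psi_def case_prod_beta)
  moreover have "(\<exists>u \<in> copy K ?B. y = x \<odot> u)" if kK: "k \<in> copy K ?A"
  proof -
    let ?w = "iv al \<odot> k \<odot> al"
    have K': "K \<lhd> W (card ?A)" using K cA by simp
    have w: "?w \<in> copy K ?B" using copy_conj[OF K' A(1) al(1,2) kK] al(3) by simp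
    have "y \<odot> ?w = y' \<odot> (al \<odot> (iv al \<odot> (k \<odot> al)))"
      using fy Y' al H_grpD[OF k] by (metis iv_closed mult_assoc mult_closed)
    also have "al \<odot> (iv al \<odot> (k \<odot> al)) = k \<odot> al"
      using al H_grpD[OF k] by (intro iv_cancel_left') (auto intro!: mult_closed src_mult_le)
    also have "y' \<odot> (k \<odot> al) = (y' \<odot> (iv y' \<odot> x')) \<odot> al"
      unfolding k_def using X' Y' al by (simp add: mult_assoc mult_closed iv_closed)
    also have "y' \<odot> (iv y' \<odot> x') = x'"
      using X' Y' by (intro iv_cancel_left') auto
    finally have "x = y \<odot> ?w" using fx by simp
    note W = H_grpD[OF copy_H_grp[OF w]]
    have "x \<odot> iv ?w = y"
      using \<open>x = y \<odot> ?w\<close> y W sy by (metis E_right iv_closed iv_right mult_assoc order_refl)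
    moreover have "iv ?w \<in> copy K ?B" using copy_iv[OF K A(2) w] .
    ultimately show ?thesis by blast
  qed
  moreover have "k \<in> copy K ?A" if uK: "u \<in> copy K ?B" and yu: "y = x \<odot> u" for u
  proof -
    note U = H_grpD[OF copy_H_grp[OF uK]]
    let ?k = "iv (iv al) \<odot> iv u \<odot> iv al"
    have "?k \<in> copy K ?A"
      using copy_conj[OF K A(2) iv_closed[OF al(1)] _ copy_iv[OF K A(2) uK]] al by simp
    moreover have "?k = k"
    proof -
      have kc: "?k \<in> carrier M" "src ?k \<subseteq> ?A"
        using al U by (simp_all add: iv_iv mult_closed iv_closed src_mult_le)
      have "y' \<odot> ?k = (y' \<odot> al) \<odot> (iv u \<odot> iv al)"
        using Y' U al by (simp add: iv_iv mult_assoc mult_closed iv_closed)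
      also have "\<dots> = x \<odot> (u \<odot> (iv u \<odot> iv al))"
        unfolding fy yu using x U al by (simp add: mult_assoc mult_closed iv_closed)
      also have "u \<odot> (iv u \<odot> iv al) = iv al"
        using U al by (intro iv_cancel_left') (auto intro: iv_closed)
      also have "x \<odot> iv al = x' \<odot> (al \<odot> iv al)"
        using fx X' al by (metis iv_closed mult_assoc)
      also have "\<dots> = x'" using X' al by (simp add: iv_right E_right)
      finally have "iv y' \<odot> (y' \<odot> ?k) = k" by (simp add: k_def)
      then show ?thesis using kc Y' by (simp add: iv_cancel_left)
    qed
    ultimately show ?thesis by simp
  qed
  ultimately show ?thesis by blast
qed

lemma sigma_bar_iff:
  assumes x: "x \<in> carrier M"
  shows "(x, y) \<in> sigma_bar G n m L \<longleftrightarrow> rank x = m \<and> (\<exists>u \<in> copy L (tgt x). y = x \<odot> u)"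
proof -
  have e: "dom (pmult (pinv (snd x)) (snd x)) = tgt x"
  proof -
    have "pmult (pinv (snd x)) (snd x) = snd (iv x \<odot> x)"
      by (cases x) (simp add: wreath_inv_def wr_inverse_def)
    then show ?thesis using iv_left[OF x] by simp
  qed
  have s: "(x, y) \<in> sigma_bar G n m L \<longleftrightarrow> y \<in> carrier M \<and> rank x = m \<and> rank y = m \<and>
      src x = src y \<and> tgt x = tgt y \<and> iv x \<odot> y \<in> copy L (tgt x)"
    using x e by (cases x; cases y) (auto simp: sigma_bar_def rk_def H_related_def L_copy_eq)
  show ?thesis
  proof
    assume "(x, y) \<in> sigma_bar G n m L"
    note * = this[unfolded s]
    have "y = x \<odot> (iv x \<odot> y)" using * x by (simp add: iv_cancel_left')
    with * show "rank x = m \<and> (\<exists>u \<in> copy L (tgt x). y = x \<odot> u)" by blast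
  next
    assume "rank x = m \<and> (\<exists>u \<in> copy L (tgt x). y = x \<odot> u)"
    then obtain u where u: "rank x = m" "u \<in> copy L (tgt x)" "y = x \<odot> u" by blast
    note U = H_grpD[OF copy_H_grp[OF u(2)]]
    have "iv x \<odot> y = u" using x U by (simp add: u(3) iv_cancel_left)
    then show "(x, y) \<in> sigma_bar G n m L"
      unfolding s using x U u by (simp add: mult_closed src_mult_eq tgt_mult_eq)
  qed
qed

lemma chi_iff: "(x, y) \<in> chi G n V \<longleftrightarrow> x \<in> carrier M \<and> y \<in> carrier M \<and> snd x = snd y \<and>
    (rank x = 0 \<or> Omega (tmult G (tinv G (fst y)) (fst x)) \<in> V (rank x))"
  by (cases x; cases y) (auto simp: chi_def rk_def)

text \<open>Parts of the three constituents overlap: below rank \<open>m\<close> the relation \<open>chi\<close> is absorbed by the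
  Rees congruence, and in rank \<open>m\<close> it is absorbed by \<open>sigma_bar\<close>, because the projection
  of \<open>T\<^bsub>m+1\<^esub>\<close> (or the trivial group, if \<open>m = n\<close>) lies in \<open>L\<close>.\<close>

lemma rho_eq_data_rel:
  assumes D: "congruence_data G n m T L"
  shows "rho G n m T L = data_rel m (normal_seq m T L)"
proof -
  let ?N = "normal_seq m T L"
  interpret normal_chain G n m ?N by (rule normal_chain_normal_seq[OF D])
  have m: "1 \<le> m" "m \<le> n" and L: "L \<lhd> W m" using D by (auto simp: congruence_data_def)
  have ran: "rank x \<le> n" if "x \<in> carrier M" for x using carrierD(5)[OF that] card_le by blast
  have refl: "(x, x) \<in> data_rel m ?N" if "x \<in> carrier M" for x
    using data_rel_equiv that by (meson equivE refl_onD)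
  have "(x, y) \<in> rho G n m T L \<longleftrightarrow> (x, y) \<in> data_rel m ?N" for x y
  proof
    assume "(x, y) \<in> rho G n m T L"
    then consider "(x, y) \<in> Rees G n (m - 1)" | "(x, y) \<in> sigma_bar G n m L"
      | "(x, y) \<in> chi G n (chi_seq G n m T)" by (auto simp: rho_def)
    then show "(x, y) \<in> data_rel m ?N"
    proof cases
      case 1
      then show ?thesis using refl m by (auto simp: Rees_def data_rel_def rk_def)
    next
      case 2
      then have x: "x \<in> carrier M" by (auto simp: sigma_bar_def)
      show ?thesis using 2 x by (auto simp: sigma_bar_iff data_rel_def normal_seq_def)
    next
      case 3
      note c = 3[unfolded chi_iff]
      show ?thesis
      proof (cases "rank x < m")
        case True then show ?thesis using c by (simp add: data_rel_def)
      next
        case False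
        let ?O = "Omega (tmult G (tinv G (fst y)) (fst x))"
        have O: "?O \<in> chi_seq G n m T (rank x)" using c False m by auto
        have "(?O, id) \<in> ?N (rank x)"
        proof (cases "rank x = m")
          case True
          show ?thesis
          proof (cases "m = n")
            case True
            then have "(?O, id) = \<one>\<^bsub>W m\<^esub>" using O \<open>rank x = m\<close> by (simp add: chi_seq_def W_diag_one)
            then show ?thesis using \<open>rank x = m\<close> subgroup.one_closed[OF normal_imp_subgroup[OF L]]
              by (simp add: normal_seq_def)
          next
            case False
            then have "?O \<in> proj (m + 1) ` T (m + 1)" using O \<open>rank x = m\<close> by (simp add: chi_seq_def)
            then show ?thesis using D False m \<open>rank x = m\<close> by (auto simp: congruence_data_def normal_seq_def)
          qed
        next
          case False
          then show ?thesis using O \<open>\<not> rank x < m\<close> by (simp add: chi_seq_def normal_seq_def)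
        qed
        then have "\<exists>u \<in> copy (?N (rank x)) (tgt x). y = x \<odot> u"
          using same_shape_factor[of x y "?N (rank x)"] c False ran N_normal[of "rank x"] by auto
        then show ?thesis using c False by (auto simp: data_rel_def)
      qed
    qed
  next
    assume "(x, y) \<in> data_rel m ?N"
    then show "(x, y) \<in> rho G n m T L"
    proof (cases rule: data_relE)
      case 1
      then have "(x, y) \<in> Rees G n (m - 1)" by (auto simp: Rees_def rk_def)
      then show ?thesis by (simp add: rho_def)
    next
      case (2 u)
      show ?thesis
      proof (cases "rank x = m")
        case True
        then have "(x, y) \<in> sigma_bar G n m L" using 2 by (auto simp: sigma_bar_iff normal_seq_def)
        then show ?thesis by (simp add: rho_def)
      next
        case False
        note U = H_grpD[OF copy_H_grp[OF 2(3)]]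
        have y: "y \<in> carrier M" using 2 U mult_closed by simp
        have "snd (Psi u) = id" using N_diag[of "rank x"] 2 ran False by (auto simp: copy_def)
        then have su: "snd u = snd (E (tgt x))" using diag_if_Psi copy_H_grp[OF 2(3)] by blast
        have "snd y i = snd x i" for i
          unfolding 2(4) by (auto simp: snd_mult su E_def ran_def split: option.split)
        then have xy: "snd x = snd y" by auto
        have "(Omega (tmult G (tinv G (fst y)) (fst x)), id) \<in> ?N (rank x)"
          using same_shape_factor[OF 2(1) y xy N_normal[OF 2(2) ran[OF 2(1)]]] 2(3,4) by blast
        then have "Omega (tmult G (tinv G (fst y)) (fst x)) \<in> chi_seq G n m T (rank x)"
          using False 2(2) by (auto simp: normal_seq_def chi_seq_def)
        then have "(x, y) \<in> chi G n (chi_seq G n m T)" using 2(1) y xy by (simp add: chi_iff)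
        then show ?thesis by (simp add: rho_def)
      qed
    qed
  qed
  then show ?thesis by auto
qed

end

section \<open>Every congruence arises in this way\<close>

locale partial_aut_congruence = partial_aut_monoid +
  fixes R :: "('a pelem \<times> 'a pelem) set"
  assumes R: "congruence M R"
begin

lemma R_sym: "(x, y) \<in> R \<Longrightarrow> (y, x) \<in> R"
  using R unfolding congruence_def by (meson equivE symD)

lemma R_trans: "(x, y) \<in> R \<Longrightarrow> (y, z) \<in> R \<Longrightarrow> (x, z) \<in> R"
  using R unfolding congruence_def by (meson equivE transD)

lemma R_refl: "x \<in> carrier M \<Longrightarrow> (x, x) \<in> R"
  using R unfolding congruence_def by (meson equivE refl_onD)

lemma R_carrier: assumes "(x, y) \<in> R" shows "x \<in> carrier M" "y \<in> carrier M"
  using R assms unfolding congruence_def equiv_def by auto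

lemma R_left: "(x, y) \<in> R \<Longrightarrow> z \<in> carrier M \<Longrightarrow> (z \<odot> x, z \<odot> y) \<in> R"
  using R unfolding congruence_def by blast

lemma R_right: "(x, y) \<in> R \<Longrightarrow> z \<in> carrier M \<Longrightarrow> (x \<odot> z, y \<odot> z) \<in> R"
  using R unfolding congruence_def by blast

lemma rank_0: assumes x: "x \<in> carrier M" and 0: "rank x = 0" shows "x = E {}"
proof -
  have "src x = {}" using 0 rank_src[OF x] carrierD(6)[OF x] by simp
  then have "snd x i = None" for i by (auto simp: domIff)
  then show ?thesis using carrierD(1)[OF x] by (intro elem_eqI) (auto simp: E_def)
qed

lemma ex_iso:
  assumes "A \<subseteq> {1..n}" "B \<subseteq> {1..n}" "card A = card B"
  obtains z where "z \<in> carrier M" "src z = A" "tgt z = B"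
proof -
  have "finite A" "finite B" using assms finite_subset by blast+
  then obtain f where "bij_betw f A B" using finite_same_card_bij assms(3) by blast
  then have "map_elem G A f \<in> carrier M" "src (map_elem G A f) = A" "tgt (map_elem G A f) = B"
    using assms by (auto simp: bij_betw_def intro!: map_elem_closed)
  then show thesis by (rule that)
qed

text \<open>The ideal of all elements of rank at most \<open>k\<close> lies in a single class, that of the zero
  element \<open>E {}\<close>. For a congruence other than the universal one, the parameter \<open>m\<close> is the least rank
  that is not collapsed.\<close>

definition collapsed :: "nat \<Rightarrow> bool"
  where "collapsed k \<longleftrightarrow> (\<forall>x \<in> carrier M. rank x \<le> k \<longrightarrow> (E {}, x) \<in> R)"

lemma collapsed_mono: "collapsed k \<Longrightarrow> j \<le> k \<Longrightarrow> collapsed j"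
  by (auto simp: collapsed_def)

lemma collapsed_0: "collapsed 0"
  unfolding collapsed_def
proof (intro ballI impI)
  fix x assume x: "x \<in> carrier M" "rank x \<le> 0"
  then have "x = E {}" by (intro rank_0) auto
  then show "(E {}, x) \<in> R" using R_refl[OF x(1)] by simp
qed

text \<open>If an idempotent is related to some element \<open>v\<close> of smaller rank, then it is related to elements
  of ever smaller rank. First \<open>v\<close> is moved inside \<open>A\<close>. As its rank is below \<open>card A\<close>, there are a
  point \<open>c\<close> in its image and a point \<open>d\<close> of \<open>A\<close> outside its domain; inserting a permutation \<open>p\<close>
  that sends \<open>c\<close> to \<open>d\<close> between two copies of \<open>v\<close> makes the product undefined at the point that \<open>v\<close>
  sends to \<open>c\<close>, while the effect of \<open>p\<close> on the idempotent can be undone.\<close>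

lemma idem_descent:
  assumes A: "A \<subseteq> {1..n}"
  shows "(v, E A) \<in> R \<Longrightarrow> rank v < card A \<Longrightarrow> (E {}, E A) \<in> R"
proof (induction "rank v" arbitrary: v rule: less_induct)
  case less
  note vM = R_carrier(1)[OF less.prems(1)]
  have EA: "E A \<in> carrier M" by (rule E_closed[OF A])
  define v' where "v' = E A \<odot> v \<odot> E A"
  have v': "v' \<in> carrier M" using vM EA by (simp add: v'_def mult_closed)
  have sv: "src v' \<subseteq> A" "tgt v' \<subseteq> A"
    unfolding v'_def by (intro src_mult_le, simp) (intro tgt_mult_le, simp)
  have RV: "(v', E A) \<in> R"
    using R_right[OF R_left[OF less.prems(1) EA] EA] by (simp add: v'_def E_mult_E)
  have "rank (E A \<odot> v) \<le> rank v"
    using carrierD(7)[OF vM] by (intro card_mono tgt_mult_le) auto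
  moreover have "rank v' \<le> rank (E A \<odot> v)"
    unfolding v'_def using carrierD(7)[OF mult_closed[OF EA vM]]
    by (subst rank_mult) (auto intro: card_mono simp: EA vM mult_closed)
  ultimately have le: "rank v' \<le> rank v" by simp
  show ?case
  proof (cases "rank v' = 0")
    case True
    then show ?thesis using rank_0[OF v'] RV by simp
  next
    case False
    then obtain c where c: "c \<in> tgt v'" by fastforce
    have fA: "finite A" using A finite_subset by blast
    have "card (src v') < card A" using rank_src[OF v'] le less.prems(2) by simp
    then have "src v' \<noteq> A" by auto
    then obtain d where d: "d \<in> A" "d \<notin> src v'" using sv by blast
    define p where "p = map_elem G A (transpose c d)"
    have perm: "transpose c d permutes A" using c d sv by (intro permutes_swap_id) auto
    then have img: "transpose c d ` A = A" by (rule permutes_image)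
    have p: "p \<in> carrier M" "src p = A" "tgt p = A"
      using A img permutes_inj_on[OF perm] by (simp_all add: p_def map_elem_closed)
    \<comment> \<open>Replacing both occurrences of \<open>v'\<close> by \<open>E A\<close> turns \<open>?w\<close> into \<open>E A\<close>.\<close>
    let ?w = "v' \<odot> p \<odot> v' \<odot> iv p"
    have w: "?w \<in> carrier M" using v' p by (simp add: mult_closed iv_closed)
    have "(v' \<odot> p \<odot> v', E A \<odot> p \<odot> v') \<in> R" using RV v' p by (intro R_right) auto
    moreover have "(E A \<odot> p \<odot> v', E A \<odot> p \<odot> E A) \<in> R" using RV EA p by (intro R_left mult_closed) auto
    moreover have "E A \<odot> p \<odot> E A = p" using p by (simp add: E_left E_right)
    ultimately have "(v' \<odot> p \<odot> v', p) \<in> R" using R_trans by metis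
    from R_right[OF this iv_closed[OF p(1)]] have Rw: "(?w, E A) \<in> R" using p by (simp add: iv_right)
    have "src ?w \<subset> src v'"
    proof -
      have "src ?w \<subseteq> src v'" by (intro src_mult_le) simp
      moreover obtain i where i: "snd v' i = Some c" using c by (auto simp: ran_def)
      moreover have "snd p c = Some d" using c sv by (auto simp: p_def map_elem_def)
      moreover have "snd v' d = None" using d by (auto simp: domIff)
      ultimately have "i \<in> src v'" "i \<notin> src ?w" by (auto simp: src_mult snd_mult)
      with \<open>src ?w \<subseteq> src v'\<close> show ?thesis by blast
    qed
    then have "rank ?w < rank v'"
      using carrierD(6)[OF v'] unfolding rank_src[OF w] rank_src[OF v'] by (rule psubset_card_mono[rotated])
    then show ?thesis using less.hyps[OF _ Rw] le less.prems(2) by simp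
  qed
qed

text \<open>Every element of rank at most \<open>card A\<close> factors through \<open>E A\<close>.\<close>

lemma collapsed_if_idem:
  assumes A: "A \<subseteq> {1..n}" and EA: "(E {}, E A) \<in> R"
  shows "collapsed (card A)"
  unfolding collapsed_def
proof (intro ballI impI)
  fix x assume x: "x \<in> carrier M" and le: "rank x \<le> card A"
  have "card (src x) \<le> card A" using le rank_src[OF x] by simp
  then obtain B where B: "B \<subseteq> A" "card B = card (src x)" by (metis obtain_subset_with_card_n)
  then obtain z where z: "z \<in> carrier M" "src z = src x" "tgt z = B"
    using ex_iso[OF carrierD(4)[OF x] order_trans[OF B(1) A]] by metis
  have zx: "iv z \<odot> x \<in> carrier M" using z x by (simp add: mult_closed iv_closed)
  have "z \<odot> E A \<odot> (iv z \<odot> x) = x" using z x zx B by (simp add: E_right iv_cancel_left')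
  moreover have "z \<odot> E {} \<odot> (iv z \<odot> x) = E {}"
  proof (rule rank_0)
    show "z \<odot> E {} \<odot> (iv z \<odot> x) \<in> carrier M"
      using mult_closed[OF mult_closed[OF z(1) E_closed] zx] by simp
    have "tgt (z \<odot> E {}) = {}" using tgt_mult_le[of "E {}" "{}" z] by simp
    then show "rank (z \<odot> E {} \<odot> (iv z \<odot> x)) = 0" by (simp add: tgt_mult)
  qed
  ultimately show "(E {}, x) \<in> R" using R_right[OF R_left[OF EA z(1)] zx] by simp
qed

lemma collapsed_if_drop:
  assumes xy: "(x, y) \<in> R" and lt: "rank y < rank x"
  shows "collapsed (rank x)"
proof -
  note x = R_carrier(1)[OF xy] and y = R_carrier(2)[OF xy]
  have "(iv x \<odot> y, E (tgt x)) \<in> R" using R_sym[OF R_left[OF xy iv_closed[OF x]]] x by (simp add: iv_left)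
  moreover have "rank (iv x \<odot> y) < card (tgt x)"
    using card_mono[OF carrierD(7)[OF y] tgt_mult_le[of y "tgt y" "iv x", OF order_refl]] lt by simp
  ultimately have "(E {}, E (tgt x)) \<in> R" by (rule idem_descent[OF carrierD(5)[OF x]])
  then show ?thesis using collapsed_if_idem carrierD(5)[OF x] by blast
qed

text \<open>Restriction to the domain of \<open>x\<close> fixes \<open>x\<close>, but if the domains differ, it leaves \<open>y\<close> with
  a rank below that of \<open>x\<close>; the same works for images.\<close>

lemma collapsed_if_le:
  assumes xy: "(x, y) \<in> R" and le: "rank y \<le> rank x" and ne: "src x \<noteq> src y \<or> tgt x \<noteq> tgt y"
  shows "collapsed (rank x)"
proof -
  note x = R_carrier(1)[OF xy] and y = R_carrier(2)[OF xy]
  have less: "card (A \<inter> B) < card A" if "A \<noteq> B" "card B \<le> card A" "finite A" "finite B" for A B :: "nat set"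
  proof -
    have "A \<inter> B \<noteq> A" using that by (metis card_seteq inf.absorb_iff2 inf_commute)
    then show ?thesis using that by (intro psubset_card_mono) auto
  qed
  from ne show ?thesis
  proof
    assume ne: "src x \<noteq> src y"
    have Es: "E (src x) \<in> carrier M" by (rule E_closed[OF carrierD(4)[OF x]])
    have "(x, E (src x) \<odot> y) \<in> R" using R_left[OF xy Es] x by (simp add: E_left)
    moreover have "rank (E (src x) \<odot> y) < rank x"
      unfolding rank_mult[OF Es y] rank_src[OF x] tgt_E
      using less[OF ne] le carrierD(6) x y by (simp add: rank_src)
    ultimately show ?thesis by (rule collapsed_if_drop)
  next
    assume ne: "tgt x \<noteq> tgt y"
    have Et: "E (tgt x) \<in> carrier M" by (rule E_closed[OF carrierD(5)[OF x]])
    have "(x, y \<odot> E (tgt x)) \<in> R" using R_right[OF xy Et] x by (simp add: E_right)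
    moreover have "rank (y \<odot> E (tgt x)) < rank x"
      unfolding rank_mult[OF y Et] src_E
      using less[OF ne] le carrierD(7) x y by (simp add: Int_commute)
    ultimately show ?thesis by (rule collapsed_if_drop)
  qed
qed

lemma H_related_if_not_collapsed:
  assumes k: "\<not> collapsed k" and xy: "(x, y) \<in> R" and "k \<le> rank x"
  shows "src x = src y" and "tgt x = tgt y"
proof -
  have "src x = src y \<and> tgt x = tgt y"
  proof (rule ccontr)
    assume ne: "\<not> (src x = src y \<and> tgt x = tgt y)"
    show False
    proof (cases "rank y \<le> rank x")
      case True
      then show ?thesis using collapsed_if_le[OF xy] ne collapsed_mono assms by blast
    next
      case False
      then have "collapsed (rank y)" using collapsed_if_le[OF R_sym[OF xy]] ne by auto
      then show ?thesis using collapsed_mono assms False by (metis linorder_le_cases order_trans)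
    qed
  qed
  then show "src x = src y" "tgt x = tgt y" by auto
qed

text \<open>If the partial bijections differed at \<open>i\<close>, deleting \<open>i\<close> from the domain of both would give
  related elements with different images, of a rank that is not collapsed.\<close>

lemma same_shape_if_not_collapsed:
  assumes k: "\<not> collapsed k" and xy: "(x, y) \<in> R" and r: "k < rank x"
  shows "snd x = snd y"
proof
  note x = R_carrier(1)[OF xy] and y = R_carrier(2)[OF xy]
  have s: "src x = src y" "tgt x = tgt y" using H_related_if_not_collapsed[OF k xy] r by auto
  fix i
  show "snd x i = snd y i"
  proof (cases "i \<in> src x")
    case False
    then show ?thesis using s by (auto simp: domIff)
  next
    case True
    then obtain c d where c: "snd x i = Some c" and d: "snd y i = Some d" using s by blast
    \<comment> \<open>After deletion of \<open>i\<close>, the images are the old ones without \<open>c\<close> and \<open>d\<close>, respectively.\<close>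
    let ?E = "E (src x - {i})"
    have E: "?E \<in> carrier M" using carrierD(4)[OF x] by (intro E_closed) auto
    have cut: "tgt (?E \<odot> z) = tgt z - {b}" if z: "z \<in> carrier M" "src z = src x" "snd z i = Some b" for z b
    proof -
      have "k \<in> tgt (?E \<odot> z) \<longleftrightarrow> (\<exists>j. j \<in> src x \<and> j \<noteq> i \<and> snd z j = Some k)" for k
        unfolding tgt_mult tgt_E by auto
      moreover have "snd z j = Some k \<Longrightarrow> j \<in> src x" for j k using z(2) by blast
      moreover have "snd z j = Some b \<longleftrightarrow> j = i" for j using carrierD(3)[OF z(1)] z(3) by blast
      moreover have "k \<in> tgt z \<longleftrightarrow> (\<exists>j. snd z j = Some k)" for k by (auto simp: ran_def)
      ultimately have "k \<in> tgt (?E \<odot> z) \<longleftrightarrow> k \<in> tgt z - {b}" for k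
        using z(3) by (metis Diff_iff option.inject singletonD singletonI)
      then show ?thesis by blast
    qed
    have "rank (?E \<odot> x) = rank x - 1"
      using cut[OF x refl c] c carrierD(7)[OF x] by (simp add: ranI)
    then have "k \<le> rank (?E \<odot> x)" using r by simp
    from H_related_if_not_collapsed(2)[OF k R_left[OF xy E] this]
    have "tgt x - {c} = tgt x - {d}" using cut[OF x refl c] cut[OF y s(1)[symmetric] d] s by simp
    moreover have "c \<in> tgt x" "d \<in> tgt x" using c d s by (auto simp: ran_def)
    ultimately have "c = d" by blast
    then show ?thesis using c d by simp
  qed
qed

text \<open>The elements of the maximal subgroup over \<open>{1..r}\<close> that are congruent to its identity, read in the
  wreath product. These are the subgroups from which \<open>L\<close> and the \<open>T\<^sub>r\<close> are recovered.\<close>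

definition R_kernel :: "nat \<Rightarrow> ((nat \<Rightarrow> 'a) \<times> (nat \<Rightarrow> nat)) set"
  where "R_kernel r = {p \<in> carrier (W r). (Phi r p, E {1..r}) \<in> R}"

lemma Phi_inv: assumes r: "r \<le> n" and p: "p \<in> carrier (W r)" shows "Phi r (inv\<^bsub>W r\<^esub> p) = iv (Phi r p)"
  using Psi_iv[OF Phi_H_grp[OF r p]] Psi_Phi[OF r p] Phi_Psi_interval[OF r H_grp_iv[OF Phi_H_grp[OF r p]]] by simp

lemma R_kernel_normal: assumes r: "r \<le> n" shows "R_kernel r \<lhd> W r"
proof -
  interpret W: group "W r" by (rule group_W[OF r])
  note Ph = H_grpD[OF Phi_H_grp[OF r]]
  have E: "E {1..r} \<in> carrier M" using r by (intro E_closed) auto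
  show ?thesis
  proof (rule W.normal_invI)
    show "subgroup (R_kernel r) (W r)"
    proof (rule W.subgroupI)
      show "R_kernel r \<subseteq> carrier (W r)" by (auto simp: R_kernel_def)
      show "R_kernel r \<noteq> {}" 
      proof -
        have "\<one>\<^bsub>W r\<^esub> \<in> R_kernel r" using R_refl[OF E] W.one_closed by (simp add: R_kernel_def Phi_one)
        then show ?thesis by blast
      qed
      show "inv\<^bsub>W r\<^esub> p \<in> R_kernel r" if "p \<in> R_kernel r" for p
      proof -
        have p: "p \<in> carrier (W r)" "(Phi r p, E {1..r}) \<in> R" using that by (auto simp: R_kernel_def)
        have "(iv (Phi r p) \<odot> E {1..r}, iv (Phi r p) \<odot> Phi r p) \<in> R"
          using R_sym[OF p(2)] Ph(1)[OF p(1)] by (intro R_left iv_closed)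
        then show ?thesis using p Ph[OF p(1)]
          by (simp add: R_kernel_def Phi_inv[OF r] iv_left E_right iv_closed)
      qed
      show "p \<otimes>\<^bsub>W r\<^esub> q \<in> R_kernel r" if "p \<in> R_kernel r" "q \<in> R_kernel r" for p q
      proof -
        have p: "p \<in> carrier (W r)" "(Phi r p, E {1..r}) \<in> R"
          and q: "q \<in> carrier (W r)" "(Phi r q, E {1..r}) \<in> R" using that by (auto simp: R_kernel_def)
        have "(Phi r p \<odot> Phi r q, E {1..r} \<odot> Phi r q) \<in> R" using p(2) Ph(1)[OF q(1)] by (rule R_right)
        then show ?thesis using p q Ph[OF q(1)] R_trans by (auto simp: R_kernel_def Phi_mult E_left)
      qed
    qed
    fix x h assume x: "x \<in> carrier (W r)" and "h \<in> R_kernel r"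
    then have h: "h \<in> carrier (W r)" "(Phi r h, E {1..r}) \<in> R" by (auto simp: R_kernel_def)
    have "(Phi r x \<odot> Phi r h \<odot> iv (Phi r x), Phi r x \<odot> E {1..r} \<odot> iv (Phi r x)) \<in> R"
      using h(2) Ph(1)[OF x] by (intro R_right R_left iv_closed)
    then show "x \<otimes>\<^bsub>W r\<^esub> h \<otimes>\<^bsub>W r\<^esub> inv\<^bsub>W r\<^esub> x \<in> R_kernel r"
      using x h Ph[OF x] by (simp add: R_kernel_def Phi_mult Phi_inv[OF r] E_right iv_right)
  qed
qed

text \<open>Conjugation by \<open>theta A\<close> respects the congruence in both directions, so the kernels over the initial
  segments determine those over all subsets.\<close>

lemma copy_R_kernel: assumes u: "u \<in> H_grp A" shows "u \<in> copy (R_kernel (card A)) A \<longleftrightarrow> (u, E A) \<in> R"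
proof -
  note T = theta[OF H_grp_subset[OF u]] and U = H_grpD[OF u]
  have "(Phi (card A) (Psi u), E {1..card A}) \<in> R \<longleftrightarrow> (u, E A) \<in> R"
  proof
    assume "(Phi (card A) (Psi u), E {1..card A}) \<in> R"
    then have "(theta A \<odot> u \<odot> iv (theta A), E {1..card A}) \<in> R" by (simp add: Phi_Psi[OF u])
    then have "(iv (theta A) \<odot> (theta A \<odot> u \<odot> iv (theta A)) \<odot> theta A,
        iv (theta A) \<odot> E {1..card A} \<odot> theta A) \<in> R"
      using T by (intro R_right R_left iv_closed)
    then show "(u, E A) \<in> R"
      using T U by (simp add: mult_assoc mult_closed iv_closed iv_cancel_left src_mult_le E_right iv_left)
  next
    assume "(u, E A) \<in> R"
    then have "(theta A \<odot> u \<odot> iv (theta A), theta A \<odot> E A \<odot> iv (theta A)) \<in> R"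
      using T by (intro R_right R_left iv_closed)
    then show "(Phi (card A) (Psi u), E {1..card A}) \<in> R"
      using T by (simp add: Phi_Psi[OF u] E_right iv_right)
  qed
  then show ?thesis using u Psi_closed[OF u] by (simp add: copy_def R_kernel_def)
qed

lemma R_kernel_proj:
  assumes r: "1 \<le> r" "r \<le> n" and t: "(t, id) \<in> R_kernel r"
  shows "(proj r t, id) \<in> R_kernel (r - 1)"
proof -
  have p: "(t, id) \<in> carrier (W r)" "(Phi r (t, id), E {1..r}) \<in> R" using t by (auto simp: R_kernel_def)
  have E: "E {1..r - 1} \<in> carrier M" using r by (intro E_closed) auto
  have "E {1..r - 1} \<odot> Phi r (t, id) = Phi (r - 1) (proj r t, id)"
    using E_mult_Phi_diag[of r "(t, id)"] H_grpD(1)[OF Phi_H_grp[OF r(2) p(1)]] by simp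
  moreover have "{1..r - 1} \<inter> {1..r} = {1..r - 1}" by auto
  ultimately have "(Phi (r - 1) (proj r t, id), E {1..r - 1}) \<in> R"
    using R_left[OF p(2) E] by (simp add: E_mult_E)
  moreover have "(proj r t, id) \<in> carrier (W (r - 1))"
    using p(1) by (auto simp: W_iff proj_def permutes_id PiE_iff)
  ultimately show ?thesis by (simp add: R_kernel_def)
qed

lemma R_kernel_diag:
  assumes k: "\<not> collapsed k" and r: "k < r" "r \<le> n" and p: "p \<in> R_kernel r"
  shows "snd p = id"
proof -
  have p: "p \<in> carrier (W r)" "(Phi r p, E {1..r}) \<in> R" using p by (auto simp: R_kernel_def)
  have "rank (Phi r p) = r" using H_grpD(3)[OF Phi_H_grp[OF r(2) p(1)]] by simp
  then have "snd (Phi r p) = snd (E {1..r})"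
    using same_shape_if_not_collapsed[OF k p(2)] r by simp
  moreover have "{1..r} \<subseteq> {1..n}" using r by auto
  ultimately have "snd (Psi (Phi r p)) = id" using Psi_diag by blast
  then show ?thesis by (simp add: Psi_Phi[OF r(2) p(1)])
qed

text \<open>Above the collapsed ranks, related elements \<open>x\<close> and \<open>y\<close> have equal domain and image, so \<open>y\<close> is
  \<open>x\<close> times \<open>iv x \<odot> y\<close>, and this factor is congruent to an idempotent.\<close>

lemma R_eq_data_rel:
  assumes k: "\<not> collapsed m" and low: "\<And>j. j < m \<Longrightarrow> collapsed j"
    and N: "\<And>r. m \<le> r \<Longrightarrow> r \<le> n \<Longrightarrow> N r = R_kernel r"
  shows "R = data_rel m N"
proof -
  have ran: "rank x \<le> n" if "x \<in> carrier M" for x using carrierD(5)[OF that] card_le by blast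
  have "(x, y) \<in> R \<longleftrightarrow> (x, y) \<in> data_rel m N" for x y
  proof
    assume xy: "(x, y) \<in> R"
    note x = R_carrier(1)[OF xy] and y = R_carrier(2)[OF xy]
    show "(x, y) \<in> data_rel m N"
    proof (cases "m \<le> rank x")
      case True
      have s: "src x = src y" "tgt x = tgt y" using H_related_if_not_collapsed[OF k xy True] by auto
      have h: "iv x \<odot> y \<in> H_grp (tgt x)"
        using x y s by (simp add: H_grp_def mult_closed iv_closed src_mult_eq tgt_mult_eq)
      have "(iv x \<odot> y, E (tgt x)) \<in> R" using R_sym[OF R_left[OF xy iv_closed[OF x]]] x by (simp add: iv_left)
      then have "iv x \<odot> y \<in> copy (N (rank x)) (tgt x)"
        using copy_R_kernel[OF h] N[OF True ran[OF x]] by simp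
      moreover have "y = x \<odot> (iv x \<odot> y)" using x y s by (simp add: iv_cancel_left')
      ultimately show ?thesis using x True unfolding data_rel_def by blast
    next
      case False
      then have "\<not> m \<le> rank y" using H_related_if_not_collapsed(2)[OF k R_sym[OF xy]] by auto
      then show ?thesis using False x y by (simp add: data_rel_def)
    qed
  next
    assume "(x, y) \<in> data_rel m N"
    then consider "x \<in> carrier M" "y \<in> carrier M" "rank x < m" "rank y < m"
      | u where "x \<in> carrier M" "m \<le> rank x" "u \<in> copy (N (rank x)) (tgt x)" "y = x \<odot> u"
      by (auto simp: data_rel_def)
    then show "(x, y) \<in> R"
    proof cases
      case 1
      then have "(E {}, x) \<in> R" "(E {}, y) \<in> R" using low by (auto simp: collapsed_def)
      then show ?thesis using R_sym R_trans by blast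
    next
      case (2 u)
      then have "(u, E (tgt x)) \<in> R" using copy_R_kernel[OF copy_H_grp[OF 2(3)]] N[OF 2(2) ran[OF 2(1)]] by simp
      from R_left[OF R_sym[OF this] 2(1)] show ?thesis using 2 by (simp add: E_right)
    qed
  qed
  then show ?thesis by auto
qed

theorem non_universal_is_rho:
  assumes ne: "R \<noteq> carrier M \<times> carrier M"
  shows "\<exists>m T L. congruence_data G n m T L \<and> R = rho G n m T L"
proof -
  have ran: "rank x \<le> n" if "x \<in> carrier M" for x using carrierD(5)[OF that] card_le by blast
  have n: "\<not> collapsed n"
  proof
    assume "collapsed n"
    then have 0: "(E {}, x) \<in> R" if "x \<in> carrier M" for x using ran[OF that] that by (simp add: collapsed_def)
    have "(x, y) \<in> R" if "x \<in> carrier M" "y \<in> carrier M" for x y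
      using R_trans[OF R_sym[OF 0] 0] that by blast
    moreover have "R \<subseteq> carrier M \<times> carrier M" using R_carrier by (intro subrelI) blast
    ultimately show False using ne by blast
  qed
  define m where "m = (LEAST k. \<not> collapsed k)"
  have m: "\<not> collapsed m" "m \<le> n" and low: "\<And>j. j < m \<Longrightarrow> collapsed j"
    unfolding m_def using n by (rule LeastI, rule Least_le) (blast dest: not_less_Least)
  have m1: "1 \<le> m" using m(1) collapsed_0 by (cases m) auto
  define T where "T r = {t. (t, id) \<in> R_kernel r}" for r
  have D: "congruence_data G n m T (R_kernel m)"
    unfolding congruence_data_def
  proof (intro conjI ballI impI m1 m(2) R_kernel_normal)
    fix i assume i: "i \<in> {m + 1..n}"
    then show "T i \<lhd> power_group G i" "perm_invariant G i (T i)"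
      using normal_diag[OF _ R_kernel_normal] by (simp_all add: T_def)
  next
    show "closed_family m n T"
      unfolding closed_family_def
    proof (intro ballI subsetI)
      fix i s assume i: "i \<in> {m + 2..n}" and "s \<in> proj i ` T i"
      then obtain t where t: "s = proj i t" "(t, id) \<in> R_kernel i" by (auto simp: T_def)
      have "1 \<le> i" "i \<le> n" using i by auto
      from R_kernel_proj[OF this t(2)] show "s \<in> T (i - 1)" by (simp add: T_def t(1))
    qed
  next
    assume "m < n"
    then show "{(t, id) |t. t \<in> proj (m + 1) ` T (m + 1)} \<subseteq> R_kernel m"
    proof -
      have "(proj (m + 1) t, id) \<in> R_kernel m" if "(t, id) \<in> R_kernel (m + 1)" for t
        using R_kernel_proj[of "m + 1" t] that \<open>m < n\<close> by simp
      then show ?thesis unfolding T_def by blast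
    qed
  qed
  have "normal_seq m T (R_kernel m) r = R_kernel r" if "m \<le> r" "r \<le> n" for r
  proof (cases "r = m")
    case True then show ?thesis by (simp add: normal_seq_def)
  next
    case False
    then have "p = (fst p, id)" if "p \<in> R_kernel r" for p
      using R_kernel_diag[OF m(1) _ \<open>r \<le> n\<close> that] \<open>m \<le> r\<close> by (metis le_neq_implies_less prod.collapse)
    then show ?thesis using False by (auto simp: normal_seq_def T_def)
  qed
  from R_eq_data_rel[OF m(1) low this] rho_eq_data_rel[OF D] have "R = rho G n m T (R_kernel m)" by simp
  with D show ?thesis by blast
qed

end

theorem theorem3p11:
  fixes G :: "('g, 'c) monoid_scheme" and n :: nat
  assumes "group G" and "1 \<le> n"
  shows "(\<forall>m T L. congruence_data G n m T L \<longrightarrow> congruence (wreath_inv G n) (rho G n m T L)) \<and>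
    (\<forall>R. congruence (wreath_inv G n) R \<longrightarrow>
       R = carrier (wreath_inv G n) \<times> carrier (wreath_inv G n) \<or>
       (\<exists>m T L. congruence_data G n m T L \<and> R = rho G n m T L))"
proof (intro conjI allI impI)
  interpret partial_aut_monoid G n using assms(1) by (rule partial_aut_monoid.intro)
  show "congruence (wreath_inv G n) (rho G n m T L)" if D: "congruence_data G n m T L" for m T L
    using normal_chain.data_rel_congruence[OF normal_chain_normal_seq[OF D]] rho_eq_data_rel[OF D] by simp
  fix R assume "congruence (wreath_inv G n) R"
  then interpret partial_aut_congruence G n R by unfold_locales
  show "R = carrier (wreath_inv G n) \<times> carrier (wreath_inv G n) \<or>
       (\<exists>m T L. congruence_data G n m T L \<and> R = rho G n m T L)"
    using non_universal_is_rho by blast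
qed

end
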